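(* For each of the following graphs $G$ on $4$ vertices, the given lists are exactly all the ordered multiplicity lists allowed in $\ddot{\mathcal{S}}(G)$, and each of these lists is spectrally arbitrary with the SSP in $\ddot{\mathcal{S}}(G)$: \begin{itemize} \item $P_4$ (path): $1111$; \item $K_{1,3}$ (star): $1111$, $121$; \item $\mathsf{Paw}$ (a triangle with one pendant vertex attached to one of its vertices): $1111$, $121$, $112$; \item $C_4$ (cycle): $1111$, $121$; \item $\mathsf{Dmnd}$ ($K_4$ minus an edge): $1111$, $121$, $112$; \item $K_4$ (complete graph): $1111$, $121$, $112$, $13$. \end{itemize}
   Context: For a simple graph $G$ on $n$ vertices, $\ddot{\mathcal{S}}(G)$ is the set of discrete Schrödinger operators of $G$: $n\times n$ real symmetric matrices (indexed by $V(G)$) whose off-diagonal $i,j$-entry is negative if $\{i,j\}$ is an edge and zero if it is not; diagonal entries are arbitrary. If a real symmetric matrix $A$ has distinct eigenvalues $\lambda_1<\cdots<\lambda_q$ with multiplicities $m_1,\ldots,m_q$, its ordered multiplicity list is $m_1\cdots m_q$ (written as a string of digits). An ordered multiplicity list is allowed in $\ddot{\mathcal{S}}(G)$ if some $A\in\ddot{\mathcal{S}}(G)$ has it. A real symmetric matrix $A$ has the strong spectral property (SSP) if $X=O$ is the only real symmetric matrix with $A\circ X=O$, $I\circ X=O$ and $AX-XA=O$ ($\circ$ is the entrywise product). An ordered multiplicity list $m_1\cdots m_q$ is spectrally arbitrary with the SSP in $\ddot{\mathcal{S}}(G)$ if for all real numbers $\lambda_1<\cdots<\lambda_q$ there is a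 matrix in $\ddot{\mathcal{S}}(G)$ with the SSP whose distinct eigenvalues are $\lambda_1,\ldots,\lambda_q$ with multiplicities $m_1,\ldots,m_q$ respectively. *)

theory Defs
  imports "Jordan_Normal_Form.Spectral_Radius"
begin

text \<open>
  A simple graph of order \<open>n\<close> has vertex set \<open>{0..<n}\<close>, the index range of an \<open>n \<times> n\<close> matrix,
  and is given by its set of edges, each a two-element set of vertices.
\<close>

definition simple_graph :: "nat \<Rightarrow> nat set set \<Rightarrow> bool" where
  "simple_graph n E \<longleftrightarrow> (\<forall>e\<in>E. e \<subseteq> {0..<n} \<and> card e = 2)"

definition P4 :: "nat set set" where
  "P4 = {{0,1}, {1,2}, {2,3}}"

definition K13 :: "nat set set" where
  "K13 = {{0,1}, {0,2}, {0,3}}"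

definition Paw :: "nat set set" where
  "Paw = {{0,1}, {0,2}, {1,2}, {0,3}}"

definition C4 :: "nat set set" where
  "C4 = {{0,1}, {1,2}, {2,3}, {3,0}}"

definition K4 :: "nat set set" where
  "K4 = {{0,1}, {0,2}, {0,3}, {1,2}, {1,3}, {2,3}}"

definition Dmnd :: "nat set set" where
  "Dmnd = K4 - {{2,3}}"

lemma simple_graphs_4:
  "simple_graph 4 P4" "simple_graph 4 K13" "simple_graph 4 Paw"
  "simple_graph 4 C4" "simple_graph 4 Dmnd" "simple_graph 4 K4"
  by (auto simp: simple_graph_def P4_def K13_def Paw_def C4_def Dmnd_def K4_def)

definition sym_mats :: "nat \<Rightarrow> real mat set" where
  "sym_mats n = {A \<in> carrier_mat n n. transpose_mat A = A}"

definition schroedinger_ops :: "nat \<Rightarrow> nat set set \<Rightarrow> real mat set" where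
  "schroedinger_ops n E =
     {A \<in> sym_mats n. \<forall>i<n. \<forall>j<n. i \<noteq> j \<longrightarrow>
        (if {i, j} \<in> E then A $$ (i, j) < 0 else A $$ (i, j) = 0)}"

text \<open>
  The spectrum of a square matrix is finite, so \<open>distinct_eigenvalues\<close> lists it in increasing order.
  For symmetric matrices the order of a root of the characteristic polynomial is
  the multiplicity of the eigenvalue in either sense, algebraic or geometric.
\<close>

definition distinct_eigenvalues :: "real mat \<Rightarrow> real list" where
  "distinct_eigenvalues A = sorted_list_of_set (spectrum A)"

definition ordered_mult_list :: "real mat \<Rightarrow> nat list" where
  "ordered_mult_list A = map (\<lambda>x. Polynomial.order x (char_poly A)) (distinct_eigenvalues A)"

definition allowed :: "nat \<Rightarrow> nat set set \<Rightarrow> nat list \<Rightarrow> bool" where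
  "allowed n E ms \<longleftrightarrow> (\<exists>A \<in> schroedinger_ops n E. ordered_mult_list A = ms)"

definition hadamard_prod :: "real mat \<Rightarrow> real mat \<Rightarrow> real mat" (infixl "\<circ>\<^sub>m" 70) where
  "A \<circ>\<^sub>m B = mat (dim_row A) (dim_col A) (\<lambda>(i, j). A $$ (i, j) * B $$ (i, j))"

definition SSP :: "nat \<Rightarrow> real mat \<Rightarrow> bool" where
  "SSP n A \<longleftrightarrow> A \<in> sym_mats n \<and>
     (\<forall>X \<in> sym_mats n.
        A \<circ>\<^sub>m X = 0\<^sub>m n n \<and> 1\<^sub>m n \<circ>\<^sub>m X = 0\<^sub>m n n \<and> A * X - X * A = 0\<^sub>m n n \<longrightarrow> X = 0\<^sub>m n n)"

definition spectrally_arbitrary_SSP :: "nat \<Rightarrow> nat set set \<Rightarrow> nat list \<Rightarrow> bool" where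
  "spectrally_arbitrary_SSP n E ms \<longleftrightarrow>
     (\<forall>ls :: real list. length ls = length ms \<and> sorted_wrt (<) ls \<longrightarrow>
        (\<exists>A \<in> schroedinger_ops n E.
           SSP n A \<and> distinct_eigenvalues A = ls \<and> ordered_mult_list A = ms))"

end

theory Submission
  imports Defs
begin

text \<open>
  Write the spectrum of an operator of a connected graph on four vertices as
  \<open>a \<le> b \<le> c \<le> d\<close>, with multiplicity.  Both halves of the theorem are statements about which
  coincidences between neighbours in this chain can occur.

  \<^bold>\<open>Which lists are excluded.\<close>  If an eigenvalue has multiplicity exceeding \<open>k\<close>, then \<open>k\<close> linear
  conditions on its eigenspace still leave a nonzero eigenvector, so there is one that vanishes at \<open>k\<close>
  prescribed vertices (\<open>eigenvector_vanishing_on\<close>).  This is the only way in which multiplicities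
  are used:

  \<^item> A double smallest eigenvalue would have an eigenvector \<open>v\<close> with a zero.  As the off-diagonal
    entries are nonpositive, \<open>\<bar>v\<bar>\<close> has no larger Rayleigh quotient, so it is again an eigenvector; a
    zero of a nonnegative eigenvector spreads along edges to the whole graph.  Hence \<open>a < b\<close>
    always.
  \<^item> On a bipartite graph the same argument works for the largest eigenvalue, with \<open>\<bar>v\<bar>\<close> given
    opposite signs on the two sides.  Hence \<open>c < d\<close> for \<open>K13\<close> and \<open>C4\<close>.
  \<^item> An eigenvector on the path that vanishes at an end vanishes everywhere, so all eigenvalues
    of \<open>P4\<close> are simple.
  \<^item> A connected graph that is not complete has an induced path \<open>i\<close>, \<open>k\<close>, \<open>j\<close>; an eigenvector that
    vanishes outside \<open>{j, k}\<close> is zero, by rows \<open>i\<close> and \<open>k\<close>.  Hence \<open>b < d\<close> for \<open>Paw\<close> and \<open>Dmnd\<close>.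

  The passage from orders of roots of the characteristic polynomial to eigenspaces rests on the
  spectral theorem for real symmetric matrices (\<open>real_symmetric_diagonalization\<close>).

  \<^bold>\<open>Why the remaining lists occur.\<close>  For each graph one explicit family of matrices realizes every
  spectrum that satisfies the inequalities above, coincidences included.  Each family is invariant
  under an automorphism that exchanges vertices, so the characteristic polynomial factors.
  For \<open>K13\<close>, \<open>Paw\<close>, \<open>C4\<close> and \<open>Dmnd\<close> a pair of twin vertices splits off one
  freely chosen eigenvalue, and what remains is a \<open>3 \<times> 3\<close> Jacobi matrix, whose spectrum can be prescribed
  together with its two end diagonal entries as long as these interlace
  (\<open>Jacobi_3_with_prescribed_ends\<close>).  For \<open>K4\<close> two pairs of twins leave a \<open>2 \<times> 2\<close> matrix, and for \<open>P4\<close>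
  the reversal splits the matrix into two \<open>2 \<times> 2\<close> matrices.  The strong spectral property is read
  off the entries of \<open>A X - X A\<close>.
\<close>

section \<open>The spectral theorem for real symmetric matrices\<close>

text \<open>
  A complex eigenvalue \<open>a\<close> with eigenvector \<open>v\<close> satisfies \<open>v\<^sup>* A v = a \<parallel>v\<parallel>\<^sup>2\<close>, and symmetry makes the
  left-hand side real.
\<close>

lemma real_symmetric_eigenvalue_exists:
  fixes A :: "real mat"
  assumes A: "A \<in> carrier_mat n n" and sym: "transpose_mat A = A" and n: "n > 0"
  shows "\<exists>a. eigenvalue A a"
proof -
  define C where "C = map_mat complex_of_real A"
  have C: "C \<in> carrier_mat n n" using A by (simp add: C_def)
  obtain a where "eigenvalue C a"
    using spectrum_non_empty[OF C n] by (auto simp: spectrum_def)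
  then obtain v where v: "v \<in> carrier_vec n" and v0: "v \<noteq> 0\<^sub>v n" and Cv: "C *\<^sub>v v = a \<cdot>\<^sub>v v"
    using C by (auto simp: eigenvalue_def eigenvector_def)
  have row: "(\<Sum>j<n. of_real (A $$ (i,j)) * v $ j) = a * v $ i" if i: "i < n" for i
  proof -
    have "(C *\<^sub>v v) $ i = (\<Sum>j<n. of_real (A $$ (i,j)) * v $ j)"
      using i v A by (auto simp: C_def scalar_prod_def lessThan_atLeast0 intro!: sum.cong)
    then show ?thesis using Cv i v by simp
  qed
  have A_sym: "A $$ (i,j) = A $$ (j,i)" if "i < n" "j < n" for i j
    using that A sym by (metis carrier_matD index_transpose_mat(1))
  \<comment> \<open>the value of the Hermitian form of \<open>A\<close> at \<open>v\<close>, which is real because \<open>A\<close> is symmetric\<close>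
  define q where "q = (\<Sum>i<n. \<Sum>j<n. cnj (v $ i) * of_real (A $$ (i,j)) * v $ j)"
  define r where "r = (\<Sum>i<n. (cmod (v $ i))\<^sup>2)"
  have "q = (\<Sum>i<n. cnj (v $ i) * (a * v $ i))"
    unfolding q_def by (intro sum.cong refl) (simp add: row[symmetric] sum_distrib_left mult.assoc)
  also have "\<dots> = a * of_real r"
    by (simp add: r_def sum_distrib_left complex_norm_square mult_ac del: of_real_power)
  finally have q: "q = a * of_real r" .
  have "cnj q = (\<Sum>i<n. \<Sum>j<n. cnj (v $ j) * of_real (A $$ (j,i)) * v $ i)"
    by (auto simp: q_def A_sym mult_ac intro!: sum.cong)
  also have "\<dots> = q" unfolding q_def by (rule sum.swap)
  finally have "cnj q = q" .
  moreover have "r \<noteq> 0"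
  proof
    assume "r = 0"
    then have "v = 0\<^sub>v n"
      using v by (intro eq_vecI) (auto simp: r_def sum_nonneg_eq_0_iff)
    with v0 show False ..
  qed
  ultimately have "cnj a = a" using q by simp
  then obtain t where t: "a = of_real t"
    by (metis Reals_cases Reals_cnj_iff)
  have "poly (char_poly C) a = 0"
    using \<open>eigenvalue C a\<close> eigenvalue_root_char_poly[OF C] by simp
  then have "poly (char_poly A) t = 0"
    unfolding t C_def of_real_hom.char_poly_hom[OF A] by simp
  then show ?thesis using eigenvalue_root_char_poly[OF A] by blast
qed

lemma orthogonal_mat_with_first_column:
  fixes v :: "real vec"
  assumes v: "v \<in> carrier_vec n" and v0: "v \<noteq> 0\<^sub>v n"
  obtains W c where "W \<in> carrier_mat n n" "transpose_mat W * W = 1\<^sub>m n" "col W 0 = c \<cdot>\<^sub>v v"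
proof -
  interpret cof_vec_space n "TYPE(real)" .
  have conj: "conjugate w = w" for w :: "real vec" by (intro eq_vecI) auto
  have n: "n > 0" using v v0 by (cases n) auto
  define b where "b = basis_completion v"
  define ws where "ws = gram_schmidt n b"
  have b: "set b \<subseteq> carrier_vec n" "distinct b" "\<not> lin_dep (set b)" "length b = n" "hd b = v"
    using basis_completion[OF v v0] by (auto simp: b_def)
  obtain vs where bv: "b = v # vs" using b(4,5) n by (cases b) auto
  have ws: "set ws \<subseteq> carrier_vec n" "corthogonal ws" "length ws = n"
    using gram_schmidt_result[OF b(1,2,3) ws_def] b(4) by auto
  have hd: "ws ! 0 = v" using gram_schmidt_hd[OF v, of vs] ws(3) n
    by (metis bv hd_conv_nth length_greater_0_conv ws_def)
  have wsc: "ws ! i \<in> carrier_vec n" if "i < n" for i using ws that by auto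
  have orth: "ws ! i \<bullet> ws ! j = 0 \<longleftrightarrow> i \<noteq> j" if "i < n" "j < n" for i j
    using corthogonalD[OF ws(2), of i j] that ws(3) by (simp add: conj)
  \<comment> \<open>the Gram--Schmidt vectors are only orthogonal, so the columns of \<open>W\<close> are divided by their norms\<close>
  define N where "N i = sqrt (ws ! i \<bullet> ws ! i)" for i
  have N: "N i * N i = ws ! i \<bullet> ws ! i" "N i \<noteq> 0" if "i < n" for i
  proof -
    have "ws ! i \<bullet> ws ! i \<ge> 0" by (auto simp: scalar_prod_def intro: sum_nonneg)
    then show "N i * N i = ws ! i \<bullet> ws ! i" "N i \<noteq> 0"
      using orth[OF that that] by (auto simp: N_def)
  qed
  define W where "W = mat n n (\<lambda>(i,j). ws ! j $ i / N j)"
  have "transpose_mat W * W = 1\<^sub>m n"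
  proof (rule eq_matI)
    fix i j assume "i < dim_row (1\<^sub>m n)" "j < dim_col (1\<^sub>m n)"
    then have i: "i < n" and j: "j < n" by auto
    have "(transpose_mat W * W) $$ (i,j) = (\<Sum>k=0..<n. ws ! i $ k / N i * (ws ! j $ k / N j))"
      using i j by (auto simp: W_def scalar_prod_def intro!: sum.cong)
    also have "\<dots> = (ws ! i \<bullet> ws ! j) / (N i * N j)"
      using wsc[OF j] by (auto simp: scalar_prod_def sum_divide_distrib)
    also have "\<dots> = 1\<^sub>m n $$ (i,j)"
      using orth[OF i j] N[OF i] i j by auto
    finally show "(transpose_mat W * W) $$ (i,j) = 1\<^sub>m n $$ (i,j)" .
  qed (auto simp: W_def)
  moreover have "col W 0 = (1 / N 0) \<cdot>\<^sub>v v"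
    using n v by (intro eq_vecI) (auto simp: W_def hd)
  ultimately show ?thesis using that[of W] by (simp add: W_def)
qed

text \<open>
  Induction on the dimension: in an orthonormal basis that starts with an eigenvector, symmetry
  clears the first row along with the first column, and the remaining block is symmetric again.
\<close>

theorem real_symmetric_diagonalization:
  fixes A :: "real mat"
  assumes "A \<in> carrier_mat n n" "transpose_mat A = A"
  shows "\<exists>P\<in>carrier_mat n n. \<exists>d. transpose_mat P * P = 1\<^sub>m n \<and> transpose_mat P * A * P = mat_diag n d"
  using assms
proof (induction n arbitrary: A)
  case 0
  show ?case
    by (rule bexI[of _ "1\<^sub>m 0"], rule exI[of _ "\<lambda>_. 0"]) (use 0 in \<open>auto intro!: eq_matI simp: mat_diag_def\<close>)
next
  case (Suc n)
  note A = Suc.prems(1) and sym = Suc.prems(2)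
  obtain a v where v: "v \<in> carrier_vec (Suc n)" "v \<noteq> 0\<^sub>v (Suc n)" and Av: "A *\<^sub>v v = a \<cdot>\<^sub>v v"
    using real_symmetric_eigenvalue_exists[OF A sym] A by (auto simp: eigenvalue_def eigenvector_def)
  obtain W c where W: "W \<in> carrier_mat (Suc n) (Suc n)" and WW: "transpose_mat W * W = 1\<^sub>m (Suc n)"
    and W0: "col W 0 = c \<cdot>\<^sub>v v"
    using orthogonal_mat_with_first_column[OF v] by metis
  define B where "B = transpose_mat W * A * W"
  have B: "B \<in> carrier_mat (Suc n) (Suc n)" using A W by (simp add: B_def)
  have symB: "transpose_mat B = B"
    using A W sym by (simp add: B_def transpose_mult[of _ "Suc n" "Suc n" _ "Suc n"]
        assoc_mult_mat[of _ "Suc n" "Suc n" _ "Suc n" _ "Suc n"])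
  have AW0: "A *\<^sub>v col W 0 = a \<cdot>\<^sub>v col W 0"
    using A v Av by (simp add: W0 mult_mat_vec smult_smult_assoc mult.commute)
  have B0: "B $$ (i,0) = (if i = 0 then a else 0)" if i: "i < Suc n" for i
  proof -
    have "B = transpose_mat W * (A * W)" using A W by (simp add: B_def)
    then have "B $$ (i,0) = col W i \<bullet> (A *\<^sub>v col W 0)"
      using A W i by (simp add: mult_mat_vec_def)
    also have "\<dots> = a * (col W i \<bullet> col W 0)" unfolding AW0 using W i by simp
    also have "col W i \<bullet> col W 0 = (transpose_mat W * W) $$ (i,0)" using W i by simp
    finally show ?thesis unfolding WW using i by simp
  qed
  define B' where "B' = mat n n (\<lambda>(i,j). B $$ (Suc i, Suc j))"
  have B': "B' \<in> carrier_mat n n" by (simp add: B'_def)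
  have symB': "transpose_mat B' = B'"
  proof (rule eq_matI)
    fix i j assume "i < dim_row B'" "j < dim_col B'"
    then show "transpose_mat B' $$ (i,j) = B' $$ (i,j)"
      using symB B by (simp add: B'_def) (metis Suc_less_eq carrier_matD index_transpose_mat(1))
  qed (auto simp: B'_def)
  let ?a = "mat 1 1 (\<lambda>_. a)"
  have Bblock: "B = four_block_mat ?a (0\<^sub>m 1 n) (0\<^sub>m n 1) B'"
  proof (rule eq_matI)
    fix i j assume "i < dim_row (four_block_mat ?a (0\<^sub>m 1 n) (0\<^sub>m n 1) B')"
      "j < dim_col (four_block_mat ?a (0\<^sub>m 1 n) (0\<^sub>m n 1) B')"
    then have i: "i < Suc n" and j: "j < Suc n" by (auto simp: B'_def)
    have "B $$ (0,j) = B $$ (j,0)" using symB B j by (metis carrier_matD index_transpose_mat(1) zero_less_Suc)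
    then show "B $$ (i,j) = four_block_mat ?a (0\<^sub>m 1 n) (0\<^sub>m n 1) B' $$ (i,j)"
      using i j B0[OF i] B0[OF j] by (cases i; cases j) (auto simp: B'_def)
  qed (use B in \<open>auto simp: B'_def\<close>)
  obtain P' d' where P': "P' \<in> carrier_mat n n" and PP': "transpose_mat P' * P' = 1\<^sub>m n"
    and D': "transpose_mat P' * B' * P' = mat_diag n d'"
    using Suc.IH[OF B' symB'] by blast
  define Q where "Q = four_block_mat (1\<^sub>m 1) (0\<^sub>m 1 n) (0\<^sub>m n 1) P'"
  have Q: "Q \<in> carrier_mat (Suc n) (Suc n)" using P' by (auto simp: Q_def)
  have QT: "transpose_mat Q = four_block_mat (1\<^sub>m 1) (0\<^sub>m 1 n) (0\<^sub>m n 1) (transpose_mat P')"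
    unfolding Q_def using P' by (subst transpose_four_block_mat) auto
  have QQ: "transpose_mat Q * Q = 1\<^sub>m (Suc n)"
    unfolding QT unfolding Q_def using P' PP'
    by (subst mult_four_block_mat[of _ 1 1 _ n _ n _ _ 1 _ n]) auto
  have QTB: "transpose_mat Q * B = four_block_mat ?a (0\<^sub>m 1 n) (0\<^sub>m n 1) (transpose_mat P' * B')"
    unfolding QT Bblock using P' B'
    by (subst mult_four_block_mat[of _ 1 1 _ n _ n _ _ 1 _ n]) auto
  have "transpose_mat Q * B * Q = four_block_mat ?a (0\<^sub>m 1 n) (0\<^sub>m n 1) (transpose_mat P' * B' * P')"
    unfolding QTB unfolding Q_def using P' B'
    by (subst mult_four_block_mat[of _ 1 1 _ n _ n _ _ 1 _ n]) auto
  also have "\<dots> = mat_diag (Suc n) (\<lambda>i. if i = 0 then a else d' (i - 1))"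
    unfolding D' by (rule eq_matI) (auto simp: mat_diag_def)
  finally have D: "transpose_mat Q * B * Q = mat_diag (Suc n) (\<lambda>i. if i = 0 then a else d' (i - 1))" .
  let ?n = "Suc n"
  have WQ: "transpose_mat (W * Q) = transpose_mat Q * transpose_mat W"
    using W Q by (simp add: transpose_mult)
  have "transpose_mat (W * Q) * (W * Q) = transpose_mat Q * (transpose_mat W * W) * Q"
    unfolding WQ using W Q by (simp add: assoc_mult_mat[of _ ?n ?n _ ?n _ ?n])
  also have "\<dots> = 1\<^sub>m ?n" unfolding WW using Q QQ by simp
  finally have "transpose_mat (W * Q) * (W * Q) = 1\<^sub>m ?n" .
  moreover have "transpose_mat (W * Q) * A * (W * Q) = transpose_mat Q * B * Q"
    unfolding WQ B_def using W Q A by (simp add: assoc_mult_mat[of _ ?n ?n _ ?n _ ?n])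
  ultimately show ?case using W Q D by (metis mult_carrier_mat)
qed

text \<open>
  The columns of \<open>P\<close> form an orthonormal eigenbasis of \<open>A\<close>, the \<open>i\<close>-th one for the eigenvalue \<open>d i\<close>.
\<close>

definition diagonalizes :: "nat \<Rightarrow> real mat \<Rightarrow> (nat \<Rightarrow> real) \<Rightarrow> real mat \<Rightarrow> bool" where
  "diagonalizes n P d A \<longleftrightarrow> P \<in> carrier_mat n n \<and> transpose_mat P * P = 1\<^sub>m n \<and>
     P * transpose_mat P = 1\<^sub>m n \<and> A = P * mat_diag n d * transpose_mat P"

lemma real_symmetric_diagonalizes:
  assumes A: "A \<in> carrier_mat n n" and sym: "transpose_mat A = A"
  obtains P d where "diagonalizes n P d A"
proof -
  obtain P d where P: "P \<in> carrier_mat n n" and PP: "transpose_mat P * P = 1\<^sub>m n"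
    and D: "transpose_mat P * A * P = mat_diag n d"
    using real_symmetric_diagonalization[OF A sym] by blast
  have PP': "P * transpose_mat P = 1\<^sub>m n"
    using mat_mult_left_right_inverse[OF _ P PP] P by simp
  have "P * mat_diag n d * transpose_mat P = (P * transpose_mat P) * A * (P * transpose_mat P)"
    unfolding D[symmetric] using P A by (simp add: assoc_mult_mat[of _ n n _ n _ n])
  also have "\<dots> = A" unfolding PP' using A by simp
  finally show ?thesis using that[of P d] P PP PP' by (simp add: diagonalizes_def)
qed

lemma char_poly_diagonalizes:
  assumes "diagonalizes n P d A"
  shows "char_poly A = (\<Prod>a\<leftarrow>map d [0..<n]. [:-a, 1:])"
proof -
  have "similar_mat A (mat_diag n d)"
    using assms unfolding similar_mat_def diagonalizes_def
    by (intro exI[of _ P] exI[of _ "transpose_mat P"] similar_mat_witI[of _ _ n]) auto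
  then have "char_poly A = char_poly (mat_diag n d)" by (rule char_poly_similar)
  also have "\<dots> = (\<Prod>a\<leftarrow>diag_mat (mat_diag n d). [:-a, 1:])"
    by (rule char_poly_upper_triangular[of _ n]) (auto simp: mat_diag_def)
  also have "diag_mat (mat_diag n d) = map d [0..<n]"
    by (auto simp: diag_mat_def mat_diag_def)
  finally show ?thesis .
qed

section \<open>Eigenvectors in an orthonormal eigenbasis\<close>

lemma mat_diag_mult_vec:
  fixes c :: "real vec"
  assumes "c \<in> carrier_vec n" "i < n"
  shows "(mat_diag n d *\<^sub>v c) $ i = d i * c $ i"
  using assms by (simp add: mat_diag_def scalar_prod_def if_distrib[where f = "\<lambda>x. x * _"] cong: if_cong)

lemma eigenvector_in_coordinates:
  assumes P: "diagonalizes n P d A" and c: "c \<in> carrier_vec n"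
    and dc: "\<And>i. i < n \<Longrightarrow> d i * c $ i = e * c $ i"
  shows "A *\<^sub>v (P *\<^sub>v c) = e \<cdot>\<^sub>v (P *\<^sub>v c)"
proof -
  have Pc: "P \<in> carrier_mat n n" and PP: "transpose_mat P * P = 1\<^sub>m n"
    and A: "A = P * mat_diag n d * transpose_mat P" using P by (auto simp: diagonalizes_def)
  have "mat_diag n d *\<^sub>v c = e \<cdot>\<^sub>v c"
  proof (rule eq_vecI)
    fix i assume "i < dim_vec (e \<cdot>\<^sub>v c)"
    then have i: "i < n" using c by simp
    then show "(mat_diag n d *\<^sub>v c) $ i = (e \<cdot>\<^sub>v c) $ i" using c dc by (simp add: mat_diag_mult_vec)
  qed (use c in \<open>auto simp: mat_diag_def\<close>)
  moreover have "A *\<^sub>v (P *\<^sub>v c) = P *\<^sub>v (mat_diag n d *\<^sub>v ((transpose_mat P * P) *\<^sub>v c))"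
    unfolding A using Pc c by (simp add: assoc_mult_mat_vec[of _ n n _ n])
  ultimately show ?thesis using PP Pc c by (simp add: mult_mat_vec)
qed

text \<open>
  With \<open>\<epsilon> = 1\<close> this is the case of the smallest eigenvalue, with \<open>\<epsilon> = -1\<close> that of the largest one.
  In the coordinates \<open>c\<close> of \<open>u\<close>, the inequality bounds the sum of the terms
  \<open>\<epsilon> (d i - e) (c i)\<^sup>2\<close> by zero; as no term is negative, \<open>u\<close> has no component in the
  other eigenspaces.
\<close>

lemma eigenvector_of_extremal_Rayleigh_quotient:
  assumes P: "diagonalizes n P d A" and u: "u \<in> carrier_vec n"
    and ext: "\<And>i. i < n \<Longrightarrow> \<epsilon> * (d i - e) \<ge> 0" and "\<epsilon> \<noteq> 0"
    and le: "\<epsilon> * (u \<bullet> (A *\<^sub>v u)) \<le> \<epsilon> * (e * (u \<bullet> u))"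
  shows "A *\<^sub>v u = e \<cdot>\<^sub>v u"
proof -
  have Pc: "P \<in> carrier_mat n n" and PP': "P * transpose_mat P = 1\<^sub>m n"
    and A: "A = P * mat_diag n d * transpose_mat P" using P by (auto simp: diagonalizes_def)
  define c where "c = transpose_mat P *\<^sub>v u"
  have c: "c \<in> carrier_vec n" using Pc u by (auto simp: c_def)
  have Pcu: "P *\<^sub>v c = u"
    using PP' Pc u by (simp add: c_def assoc_mult_mat_vec[symmetric, of _ n n _ n])
  have "A *\<^sub>v u = P *\<^sub>v (mat_diag n d *\<^sub>v c)"
    unfolding A c_def using Pc u by (simp add: assoc_mult_mat_vec[of _ n n _ n])
  moreover have Dc: "mat_diag n d *\<^sub>v c \<in> carrier_vec n"
    by (rule mult_mat_vec_carrier[of _ n n]) (use c in auto)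
  ultimately have "u \<bullet> (A *\<^sub>v u) = c \<bullet> (mat_diag n d *\<^sub>v c)"
    using transpose_vec_mult_scalar[OF Pc Dc u] by (simp add: c_def)
  moreover have "dim_row (mat_diag n d) = n" by (simp add: mat_diag_def)
  ultimately have uAu: "u \<bullet> (A *\<^sub>v u) = (\<Sum>i=0..<n. d i * (c $ i)\<^sup>2)"
    using c Dc by (simp add: scalar_prod_def[of c] mat_diag_mult_vec power2_eq_square mult_ac
        del: index_mult_mat_vec)
  have "u \<bullet> u = c \<bullet> c"
    using transpose_vec_mult_scalar[OF Pc c u] unfolding Pcu by (simp add: c_def[symmetric])
  then have uu: "u \<bullet> u = (\<Sum>i=0..<n. (c $ i)\<^sup>2)"
    using c by (simp add: scalar_prod_def power2_eq_square)
  have "(\<Sum>i=0..<n. \<epsilon> * (d i - e) * (c $ i)\<^sup>2) \<le> 0"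
    using le unfolding uAu uu by (simp add: sum_distrib_left sum_subtractf algebra_simps)
  moreover have nonneg: "\<epsilon> * (d i - e) * (c $ i)\<^sup>2 \<ge> 0" if "i < n" for i
    using ext[OF that] by simp
  ultimately have "(\<Sum>i=0..<n. \<epsilon> * (d i - e) * (c $ i)\<^sup>2) = 0"
    by (intro antisym sum_nonneg) auto
  then have "\<epsilon> * (d i - e) * (c $ i)\<^sup>2 = 0" if "i < n" for i
    using nonneg that by (subst (asm) sum_nonneg_eq_0_iff) auto
  then have "d i * c $ i = e * c $ i" if "i < n" for i using that \<open>\<epsilon> \<noteq> 0\<close> by fastforce
  from eigenvector_in_coordinates[OF P c this] show ?thesis by (simp add: Pcu)
qed

text \<open>
  The coordinates of the desired vector solve a homogeneous system with one equation for each
  column of \<open>P\<close> that belongs to an eigenvalue other than \<open>e\<close> and one for each element of \<open>S\<close>, hence with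
  fewer equations than unknowns.
\<close>

lemma eigenvector_vanishing_on:
  assumes P: "diagonalizes n P d A" and S: "S \<subseteq> {..<n}" and less: "card S < card {i. i < n \<and> d i = e}"
  obtains v where "v \<in> carrier_vec n" "v \<noteq> 0\<^sub>v n" "A *\<^sub>v v = e \<cdot>\<^sub>v v" "\<And>i. i \<in> S \<Longrightarrow> v $ i = 0"
proof -
  have Pc: "P \<in> carrier_mat n n" and PP: "transpose_mat P * P = 1\<^sub>m n"
    using P by (auto simp: diagonalizes_def)
  let ?J = "{i. i < n \<and> d i = e}"
  have finS: "finite S" using S finite_subset by blast
  obtain g where g: "g ` S \<subseteq> ?J" "inj_on g S"
    using card_le_inj[of S ?J] less finS by auto
  have "card (g ` S) < card ?J" using card_image[OF g(2)] less by simp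
  then obtain k where k: "k \<in> ?J" "k \<notin> g ` S" using g(1) by (metis (no_types, lifting) less_irrefl subsetI subset_antisym)
  \<comment> \<open>The rows of \<open>M\<close> are the equations: row \<open>i\<close> with \<open>d i \<noteq> e\<close> kills the coordinate \<open>i\<close>, row \<open>g i\<close> makes the
    entry at \<open>i \<in> S\<close> vanish, and the rows left over, among them row \<open>k\<close>, are zero.\<close>
  define r where "r i = (if i \<notin> ?J then unit_vec n i else row P (inv_into S g i))" for i
  define M where "M = mat\<^sub>r n n (\<lambda>i. if i \<in> ?J - g ` S then 0\<^sub>v n else r i)"
  have r: "r i \<in> carrier_vec n" if "i < n" for i using Pc by (auto simp: r_def)
  have M: "M \<in> carrier_mat n n" by (simp add: M_def)
  have "M = mat\<^sub>r n n (\<lambda>i. if i = k then 0\<^sub>v n else if i \<in> ?J - g ` S then 0\<^sub>v n else r i)"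
    using k unfolding M_def by (intro arg_cong[of _ _ "mat\<^sub>r n n"]) auto
  also have "det \<dots> = 0" using k r by (intro det_row_0) auto
  finally have "det M = 0" .
  then obtain c where c: "c \<in> carrier_vec n" "c \<noteq> 0\<^sub>v n" and Mc: "M *\<^sub>v c = 0\<^sub>v n"
    using det_0_iff_vec_prod_zero[OF M] by auto
  have rc: "r i \<bullet> c = 0" if "i < n" "i \<notin> ?J - g ` S" for i
  proof -
    have "(M *\<^sub>v c) $ i = r i \<bullet> c" using that r[OF that(1)] by (auto simp: M_def)
    then show ?thesis using Mc that by simp
  qed
  have "d i * c $ i = e * c $ i" if "i < n" for i
    using rc[of i] that c by (cases "d i = e") (auto simp: r_def)
  from eigenvector_in_coordinates[OF P c(1) this]
  have "A *\<^sub>v (P *\<^sub>v c) = e \<cdot>\<^sub>v (P *\<^sub>v c)" .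
  moreover have "P *\<^sub>v c \<noteq> 0\<^sub>v n"
  proof
    assume "P *\<^sub>v c = 0\<^sub>v n"
    then have "(transpose_mat P * P) *\<^sub>v c = 0\<^sub>v n"
      using Pc c by (auto simp: assoc_mult_mat_vec[of _ n n _ n])
    with c show False by (simp add: PP)
  qed
  moreover have "(P *\<^sub>v c) $ i = 0" if i: "i \<in> S" for i
  proof -
    have "g i \<in> ?J" "i < n" using i g(1) S by auto
    then show ?thesis using rc[of "g i"] i g(2) Pc by (auto simp: r_def)
  qed
  ultimately show ?thesis using that[of "P *\<^sub>v c"] Pc c by simp
qed

section \<open>Extremal eigenvalues of connected graphs\<close>

text \<open>
  Connectedness is used in the form that a nonempty set of vertices without outgoing edges is the
  whole vertex set.
\<close>

definition connected_graph :: "nat \<Rightarrow> nat set set \<Rightarrow> bool" where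
  "connected_graph n E \<longleftrightarrow> (\<forall>T\<subseteq>{..<n}. T \<noteq> {} \<longrightarrow>
     (\<forall>i\<in>T. \<forall>j<n. {i,j} \<in> E \<longrightarrow> j \<in> T) \<longrightarrow> T = {..<n})"

text \<open>
  The Perron--Frobenius argument, for either end of the spectrum.  The vector \<open>s\<close> records the signs
  of the competitor \<open>u = s \<bar>v\<bar>\<close>: constant for the smallest eigenvalue, opposite on the two sides of a
  bipartition for the largest one.  In both cases the hypothesis on \<open>s\<close> says that replacing
  \<open>v\<close> by \<open>u\<close> moves the quadratic form towards that end of the spectrum.
\<close>

lemma extremal_eigenvalue_simple:
  assumes A: "A \<in> schroedinger_ops n E" and conn: "connected_graph n E" and n: "n > 0"
    and P: "diagonalizes n P d A"
    and ext: "\<And>i. i < n \<Longrightarrow> \<epsilon> * (d i - e) \<ge> 0" and \<epsilon>: "\<epsilon> \<noteq> 0"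
    and s: "\<And>i. s i = 1 \<or> s i = (-1::real)"
    and sE: "\<And>i j. i < n \<Longrightarrow> j < n \<Longrightarrow> i \<noteq> j \<Longrightarrow> {i,j} \<in> E \<Longrightarrow> \<epsilon> * s i * s j \<ge> 0"
  shows "card {i. i < n \<and> d i = e} \<le> 1"
proof (rule ccontr)
  assume "\<not> ?thesis"
  then have "card {0} < card {i. i < n \<and> d i = e}" by simp
  with eigenvector_vanishing_on[OF P, of "{0}" e] n obtain v
    where v: "v \<in> carrier_vec n" "v \<noteq> 0\<^sub>v n" "A *\<^sub>v v = e \<cdot>\<^sub>v v" and v0: "v $ 0 = 0"
    by auto
  have Ac: "A \<in> carrier_mat n n"
    and off: "\<And>i j. i < n \<Longrightarrow> j < n \<Longrightarrow> i \<noteq> j \<Longrightarrow> if {i,j} \<in> E then A $$ (i,j) < 0 else A $$ (i,j) = 0"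
    using A by (auto simp: schroedinger_ops_def sym_mats_def)
  define u where "u = vec n (\<lambda>i. s i * \<bar>v $ i\<bar>)"
  have u: "u \<in> carrier_vec n" by (simp add: u_def)
  have ss: "s i * s i = 1" for i using s[of i] by auto
  have quad: "x \<bullet> (A *\<^sub>v x) = (\<Sum>i<n. \<Sum>j<n. A $$ (i,j) * (x $ i * x $ j))" if "x \<in> carrier_vec n" for x
    using that Ac by (auto simp: scalar_prod_def lessThan_atLeast0 sum_distrib_left mult_ac intro!: sum.cong)
  have off_neg: "\<epsilon> * s i * s j * A $$ (i,j) \<le> 0" if "i < n" "j < n" "i \<noteq> j" for i j
    using off[OF that] sE[OF that] by (auto split: if_splits intro: mult_nonneg_nonpos)
  have term_le: "\<epsilon> * (A $$ (i,j) * (u $ i * u $ j)) \<le> \<epsilon> * (A $$ (i,j) * (v $ i * v $ j))"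
    if i: "i < n" and j: "j < n" for i j
  proof (cases "i = j")
    case True
    have "u $ i * u $ i = v $ i * v $ i" using i ss[of i] by (simp add: u_def algebra_simps)
    then show ?thesis using True by simp
  next
    case False
    let ?b = "\<epsilon> * s i * s j * A $$ (i,j)"
    have "\<epsilon> * (A $$ (i,j) * (u $ i * u $ j)) = ?b * \<bar>v $ i * v $ j\<bar>"
      using i j by (simp add: u_def abs_mult)
    also have "\<dots> \<le> ?b * (s i * s j * (v $ i * v $ j))"
    proof (rule mult_left_mono_neg[OF _ off_neg[OF i j False]])
      show "s i * s j * (v $ i * v $ j) \<le> \<bar>v $ i * v $ j\<bar>" using s[of i] s[of j] by auto
    qed
    also have "\<dots> = (s i * s i) * (s j * s j) * (\<epsilon> * (A $$ (i,j) * (v $ i * v $ j)))"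
      by (simp only: mult_ac)
    finally show ?thesis by (simp add: ss)
  qed
  have "\<epsilon> * (u \<bullet> (A *\<^sub>v u)) \<le> \<epsilon> * (v \<bullet> (A *\<^sub>v v))"
    unfolding quad[OF u] quad[OF v(1)] sum_distrib_left by (intro sum_mono term_le) auto
  also have "v \<bullet> (A *\<^sub>v v) = e * (v \<bullet> v)" using v by simp
  also have "v \<bullet> v = u \<bullet> u"
    using v(1) by (auto simp: scalar_prod_def u_def ss algebra_simps intro!: sum.cong)
  finally have Au: "A *\<^sub>v u = e \<cdot>\<^sub>v u"
    using eigenvector_of_extremal_Rayleigh_quotient[OF P u ext \<epsilon>] by simp
  \<comment> \<open>Where \<open>u\<close> vanishes, the eigenvalue equation is a vanishing sum of terms of one sign, so \<open>u\<close> vanishes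
    at the neighbours as well.\<close>
  define T where "T = {i. i < n \<and> v $ i = 0}"
  have "j \<in> T" if i: "i \<in> T" and j: "j < n" and ij: "{i,j} \<in> E" for i j
  proof (cases "j = i")
    case False
    have "(\<Sum>k=0..<n. A $$ (i,k) * u $ k) = e * u $ i"
      using arg_cong[OF Au, of "\<lambda>w. w $ i"] i Ac u by (auto simp: T_def scalar_prod_def)
    then have "\<epsilon> * s i * (\<Sum>k=0..<n. A $$ (i,k) * u $ k) = 0"
      using i by (simp add: T_def u_def)
    then have sum0: "(\<Sum>k=0..<n. - (\<epsilon> * s i * s k * A $$ (i,k) * \<bar>v $ k\<bar>)) = 0"
      by (simp add: sum_distrib_left u_def sum_negf mult_ac)
    have nonneg: "- (\<epsilon> * s i * s k * A $$ (i,k) * \<bar>v $ k\<bar>) \<ge> 0" if "k < n" for k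
      using off_neg[of i k] i that by (cases "k = i") (auto simp: T_def intro: mult_nonpos_nonneg)
    have "\<epsilon> * s i * s j * A $$ (i,j) * \<bar>v $ j\<bar> = 0"
      using sum0 nonneg j by (subst (asm) sum_nonneg_eq_0_iff) auto
    moreover have "A $$ (i,j) \<noteq> 0" "s i \<noteq> 0" "s j \<noteq> 0"
      using off[of i j] i j ij False s[of i] s[of j] by (auto simp: T_def)
    ultimately show ?thesis using \<epsilon> j by (simp add: T_def)
  qed (use i in simp)
  moreover have "T \<subseteq> {..<n}" "0 \<in> T" using n v0 by (auto simp: T_def)
  ultimately have "T = {..<n}" using conn unfolding connected_graph_def by blast
  then have "v = 0\<^sub>v n" using v(1) by (intro eq_vecI) (auto simp: T_def)
  with v(2) show False ..
qed

section \<open>From the characteristic polynomial to the ordered multiplicity list\<close>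

lemma order_prod_linear_factors:
  fixes x :: "'a :: idom"
  shows "Polynomial.order x (\<Prod>a\<leftarrow>as. [:-a, 1:]) = count_list as x"
proof (induction as)
  case Nil
  then show ?case by (simp add: order_1_eq_0)
next
  case (Cons a as)
  have "Polynomial.order x [:-a, 1:] = (if x = a then 1 else 0)"
    using order_power_n_n[of a 1] by (auto simp: order_root intro!: order_0I)
  moreover have "(\<Prod>a\<leftarrow>as. [:-a, 1:]) \<noteq> 0" by (auto simp: prod_list_zero_iff)
  then have "[:-a, 1:] * (\<Prod>a\<leftarrow>as. [:-a, 1:]) \<noteq> 0" by (metis mult_eq_0_iff one_neq_zero pCons_eq_0_iff)
  ultimately show ?case using Cons.IH by (simp add: order_mult del: mult_pCons_left)
qed

lemma roots_prod_linear_factors: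
  fixes as :: "'a :: idom list"
  shows "{k. poly (\<Prod>a\<leftarrow>as. [:-a, 1:]) k = 0} = set as"
  by (induction as) (auto simp del: mult_pCons_left)

lemma multiplicities_of_linear_factors:
  fixes A :: "real mat"
  assumes A: "A \<in> carrier_mat n n"
    and cp: "char_poly A = (\<Prod>a\<leftarrow>concat (map2 replicate ms ls). [:-a, 1:])"
    and len: "length ms = length ls" and ls: "sorted_wrt (<) ls" and ms: "0 \<notin> set ms"
  shows "distinct_eigenvalues A = ls" "ordered_mult_list A = ms"
proof -
  have dist: "distinct ls" and srt: "sorted ls"
    using ls by (simp_all add: strict_sorted_iff)
  have "spectrum A = set (concat (map2 replicate ms ls))"
    unfolding spectrum_root_char_poly[OF A] cp by (rule roots_prod_linear_factors)
  also have "\<dots> = set ls"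
    using len ms by (induction ms ls rule: list_induct2) auto
  finally show ev: "distinct_eigenvalues A = ls"
    unfolding distinct_eigenvalues_def using sorted_list_of_set.idem_if_sorted_distinct[OF srt dist] by simp
  have "map (count_list (concat (map2 replicate ms ls))) ls = ms"
    using len dist
  proof (induction ms ls rule: list_induct2)
    case (Cons m ms l ls)
    have "count_list (concat (map2 replicate ms ls)) l = 0"
      using Cons.prems by (auto simp: count_list_0_iff dest: set_zip_rightD)
    moreover have "count_list (replicate m l) l = m" "\<And>x. x \<noteq> l \<Longrightarrow> count_list (replicate m l) x = 0"
      by (induction m) auto
    moreover have "\<And>x. x \<in> set ls \<Longrightarrow> x \<noteq> l" using Cons.prems by auto
    ultimately show ?case using Cons.prems Cons.IH by (simp cong: map_cong)
  qed simp
  then show "ordered_mult_list A = ms"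
    by (simp add: ordered_mult_list_def ev cp order_prod_linear_factors)
qed

text \<open>
  The ordered multiplicity list of a spectrum \<open>a < b \<le> c \<le> d\<close>.
\<close>

definition mult_pattern :: "real \<Rightarrow> real \<Rightarrow> real \<Rightarrow> real \<Rightarrow> nat list" where
  "mult_pattern a b c d =
     (if b < c then if c < d then [1,1,1,1] else [1,1,2] else if c < d then [1,2,1] else [1,3])"

lemma ordered_mult_list_4:
  assumes A: "A \<in> carrier_mat 4 4" and cp: "char_poly A = (\<Prod>x\<leftarrow>[a,b,c,d]. [:-x, 1:])"
    and le: "a < b" "b \<le> c" "c \<le> d"
  shows "distinct_eigenvalues A = remdups [a,b,c,d]" "ordered_mult_list A = mult_pattern a b c d"
proof -
  let ?ls = "remdups [a,b,c,d]" and ?ms = "mult_pattern a b c d"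
  have "concat (map2 replicate ?ms ?ls) = [a,b,c,d]" "length ?ms = length ?ls"
    "sorted_wrt (<) ?ls" "0 \<notin> set ?ms"
    using le by (auto simp: mult_pattern_def numeral_eq_Suc)
  with multiplicities_of_linear_factors[OF A, of ?ms ?ls] cp
  show "distinct_eigenvalues A = ?ls" "ordered_mult_list A = ?ms" by auto
qed

section \<open>Restrictions on the spectra of graphs on four vertices\<close>

text \<open>
  The last conclusion makes the multiplicity of an eigenvalue available as the dimension of its eigenspace.
\<close>

lemma sorted_spectrum_4:
  assumes A: "A \<in> schroedinger_ops 4 E" and conn: "connected_graph 4 E"
  obtains P f a b c d where "diagonalizes 4 P f A" "char_poly A = (\<Prod>x\<leftarrow>[a,b,c,d]. [:-x, 1:])"
    "a < b" "b \<le> c" "c \<le> d" "\<forall>i<4. f i \<le> d"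
    "\<forall>x. card {i. i < 4 \<and> f i = x} = count_list [a,b,c,d] x"
proof -
  obtain P f where P: "diagonalizes 4 P f A"
    using A real_symmetric_diagonalizes[of A 4] by (auto simp: schroedinger_ops_def sym_mats_def)
  define es where "es = sort (map f [0..<4])"
  have "length es = 4" by (simp add: es_def)
  then obtain a b c d where es: "es = [a,b,c,d]" by (auto simp: numeral_eq_Suc length_Suc_conv)
  have "sorted es" by (simp add: es_def)
  then have le: "a \<le> b" "b \<le> c" "c \<le> d" by (auto simp: es)
  have mset: "mset es = mset (map f [0..<4])" by (simp add: es_def)
  have "char_poly A = (\<Prod>x\<leftarrow>map f [0..<4]. [:-x, 1:])" by (rule char_poly_diagonalizes[OF P])
  also have "\<dots> = (\<Prod>x\<leftarrow>es. [:-x, 1:])"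
    using arg_cong[OF mset, of "\<lambda>M. prod_mset (image_mset (\<lambda>x. [:-x, 1:]) M)"]
    by (simp only: mset_map[symmetric] prod_mset_prod_list)
  finally have cp: "char_poly A = (\<Prod>x\<leftarrow>[a,b,c,d]. [:-x, 1:])" by (simp add: es)
  have count: "card {i. i < 4 \<and> f i = x} = count_list [a,b,c,d] x" for x
  proof -
    have "count_list es x = length (filter ((=) x) (map f [0..<4]))"
      using arg_cong[OF mset, of "\<lambda>M. count M x"] by (simp only: count_mset count_list_eq_length_filter)
    also have "\<dots> = card {i. i < 4 \<and> f i = x}"
      unfolding length_filter_conv_card by (rule arg_cong[of _ _ card]) auto
    finally show ?thesis by (simp add: es)
  qed
  have set: "set es = f ` {..<4}" by (auto simp: es_def)
  have bounds: "a \<le> f i" "f i \<le> d" if "i < 4" for i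
  proof -
    have "f i \<in> set es" using that set by auto
    then show "a \<le> f i" "f i \<le> d" using le by (auto simp: es)
  qed
  have "card {i. i < 4 \<and> f i = a} \<le> 1"
    by (rule extremal_eigenvalue_simple[OF A conn _ P, of 1 _ "\<lambda>_. 1"]) (use bounds in auto)
  then have "a < b" using le by (auto simp: count split: if_splits)
  from that[OF P cp this le(2,3)] bounds(2) count show ?thesis by simp
qed

lemma largest_eigenvalue_simple_bipartite:
  assumes A: "A \<in> schroedinger_ops 4 E" and conn: "connected_graph 4 E"
    and bip: "\<And>i j. {i,j} \<in> E \<Longrightarrow> i \<in> V \<longleftrightarrow> j \<notin> V"
  shows "\<exists>a b c d. a < b \<and> b \<le> c \<and> c < d \<and> char_poly A = (\<Prod>x\<leftarrow>[a,b,c,d]. [:-x, 1:])"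
proof -
  obtain P f a b c d where P: "diagonalizes 4 P f A" and cp: "char_poly A = (\<Prod>x\<leftarrow>[a,b,c,d]. [:-x, 1:])"
    and le: "a < b" "b \<le> c" "c \<le> d" and fd: "\<forall>i<4. f i \<le> d"
    and count: "\<forall>x. card {i. i < 4 \<and> f i = x} = count_list [a,b,c,d] x"
    by (rule sorted_spectrum_4[OF A conn]) (rule that; assumption)
  have "card {i. i < 4 \<and> f i = d} \<le> 1"
    by (rule extremal_eigenvalue_simple[OF A conn _ P, of "-1" _ "\<lambda>i. if i \<in> V then 1 else -1"])
      (use fd bip in auto)
  then have "c < d" using le by (auto simp: count split: if_splits)
  with cp le show ?thesis by blast
qed

text \<open>
  A triple eigenvalue would have a nonzero eigenvector supported on \<open>{j, k}\<close>.  Row \<open>i\<close> involves only its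
  entry at \<open>k\<close>, and then row \<open>k\<close> only its entry at \<open>j\<close>, so both entries vanish.
\<close>

lemma no_triple_eigenvalue_induced_path:
  assumes A: "A \<in> schroedinger_ops 4 E" and conn: "connected_graph 4 E"
    and ijk: "i < 4" "j < 4" "k < 4" "i \<noteq> j" "{i,k} \<in> E" "{k,j} \<in> E" "{i,j} \<notin> E" "i \<noteq> k" "j \<noteq> k"
  shows "\<exists>a b c d. a < b \<and> b \<le> c \<and> c \<le> d \<and> b < d \<and> char_poly A = (\<Prod>x\<leftarrow>[a,b,c,d]. [:-x, 1:])"
proof -
  obtain P f a b c d where P: "diagonalizes 4 P f A" and cp: "char_poly A = (\<Prod>x\<leftarrow>[a,b,c,d]. [:-x, 1:])"
    and le: "a < b" "b \<le> c" "c \<le> d"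
    and count: "\<forall>x. card {i. i < 4 \<and> f i = x} = count_list [a,b,c,d] x"
    by (rule sorted_spectrum_4[OF A conn]) (rule that; assumption)
  have Ac: "A \<in> carrier_mat 4 4"
    and off: "\<And>i j. i < 4 \<Longrightarrow> j < 4 \<Longrightarrow> i \<noteq> j \<Longrightarrow> if {i,j} \<in> E then A $$ (i,j) < 0 else A $$ (i,j) = 0"
    using A by (auto simp: schroedinger_ops_def sym_mats_def)
  have "b \<noteq> d"
  proof
    assume "b = d"
    then have "card {i. i < 4 \<and> f i = d} = 3" using le by (auto simp: count)
    moreover have "card ({..<4} - {j,k}) = 2" using ijk by (simp add: card_Diff_subset)
    ultimately have "card ({..<4} - {j,k}) < card {i. i < 4 \<and> f i = d}" by simp
    then obtain v where v: "v \<in> carrier_vec 4" "v \<noteq> 0\<^sub>v 4" "A *\<^sub>v v = d \<cdot>\<^sub>v v"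
      and v0: "\<And>i. i \<in> {..<4} - {j,k} \<Longrightarrow> v $ i = 0"
      using eigenvector_vanishing_on[OF P, of "{..<4} - {j,k}" d] by auto
    have row: "A $$ (m,j) * v $ j + A $$ (m,k) * v $ k = d * v $ m" if m: "m < 4" for m
    proof -
      have "d * v $ m = (\<Sum>l\<in>{..<4}. A $$ (m,l) * v $ l)"
        using arg_cong[OF v(3), of "\<lambda>w. w $ m"] m v(1) Ac
        by (auto simp: scalar_prod_def lessThan_atLeast0)
      also have "\<dots> = (\<Sum>l\<in>{j,k}. A $$ (m,l) * v $ l)"
        using ijk v0 by (intro sum.mono_neutral_right) auto
      finally show ?thesis using ijk by simp
    qed
    have "v $ k = 0" using row[of i] off[of i j] off[of i k] v0[of i] ijk by auto
    moreover from this have "v $ j = 0" using row[of k] off[of k j] ijk by auto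
    ultimately have "v = 0\<^sub>v 4" using v(1) v0 by (intro eq_vecI) auto
    with v(2) show False ..
  qed
  with cp le show ?thesis by (intro exI[of _ a] exI[of _ b] exI[of _ c] exI[of _ d]) auto
qed

lemma less_4_iff: "(i::nat) < 4 \<longleftrightarrow> i = 0 \<or> i = 1 \<or> i = 2 \<or> i = 3" by auto

lemma all_less_4: "(\<forall>i<4. Q i) \<longleftrightarrow> Q 0 \<and> Q 1 \<and> Q 2 \<and> Q (3::nat)" by (auto simp: less_4_iff)

lemma sum_less_4: "(\<Sum>i=0..<4. f i) = f 0 + f 1 + f 2 + f (3::nat)" by (simp add: eval_nat_numeral)

lemma connected_graph_mono:
  assumes "connected_graph n E" "E \<subseteq> F" shows "connected_graph n F"
  unfolding connected_graph_def
proof (intro allI impI)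
  fix T :: "nat set"
  assume T: "T \<subseteq> {..<n}" "T \<noteq> {}" and closed: "\<forall>i\<in>T. \<forall>j<n. {i,j} \<in> F \<longrightarrow> j \<in> T"
  have "\<forall>i\<in>T. \<forall>j<n. {i,j} \<in> E \<longrightarrow> j \<in> T" using closed assms(2) by blast
  then show "T = {..<n}" using assms(1)[unfolded connected_graph_def, rule_format, OF T] by simp
qed

lemma connected_graph_P4: "connected_graph 4 P4"
  unfolding connected_graph_def
proof (intro allI impI)
  fix T :: "nat set" assume T: "T \<subseteq> {..<4}" "T \<noteq> {}" "\<forall>i\<in>T. \<forall>j<4. {i,j} \<in> P4 \<longrightarrow> j \<in> T"
  have step: "j \<in> T" if "i \<in> T" "j < 4" "{i,j} \<in> P4" for i j
    using T(3)[rule_format, OF that] .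
  have e0: "0 \<in> T \<longleftrightarrow> 1 \<in> T"
    using step[of 0 1] step[of 1 0] by (simp add: P4_def doubleton_eq_iff) blast
  have e1: "1 \<in> T \<longleftrightarrow> 2 \<in> T"
    using step[of 1 2] step[of 2 1] by (simp add: P4_def doubleton_eq_iff) blast
  have e2: "2 \<in> T \<longleftrightarrow> 3 \<in> T"
    using step[of 2 3] step[of 3 2] by (simp add: P4_def doubleton_eq_iff) blast
  obtain i where "i \<in> T" using T(2) by blast
  moreover from this have "i = 0 \<or> i = 1 \<or> i = 2 \<or> i = 3" using T(1) less_4_iff[of i] by blast
  ultimately have "0 \<in> T" "1 \<in> T" "2 \<in> T" "3 \<in> T" using e0 e1 e2 by blast+
  then have "j \<in> T" if "j < 4" for j using that unfolding less_4_iff by blast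
  with T(1) show "T = {..<4}" by auto
qed

lemma connected_graph_K13: "connected_graph 4 K13"
  unfolding connected_graph_def
proof (intro allI impI)
  fix T :: "nat set" assume T: "T \<subseteq> {..<4}" "T \<noteq> {}" "\<forall>i\<in>T. \<forall>j<4. {i,j} \<in> K13 \<longrightarrow> j \<in> T"
  have step: "j \<in> T" if "i \<in> T" "j < 4" "{i,j} \<in> K13" for i j
    using T(3)[rule_format, OF that] .
  have e0: "0 \<in> T \<longleftrightarrow> 1 \<in> T"
    using step[of 0 1] step[of 1 0] by (simp add: K13_def doubleton_eq_iff) blast
  have e1: "0 \<in> T \<longleftrightarrow> 2 \<in> T"
    using step[of 0 2] step[of 2 0] by (simp add: K13_def doubleton_eq_iff) blast
  have e2: "0 \<in> T \<longleftrightarrow> 3 \<in> T"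
    using step[of 0 3] step[of 3 0] by (simp add: K13_def doubleton_eq_iff) blast
  obtain i where "i \<in> T" using T(2) by blast
  moreover from this have "i = 0 \<or> i = 1 \<or> i = 2 \<or> i = 3" using T(1) less_4_iff[of i] by blast
  ultimately have "0 \<in> T" "1 \<in> T" "2 \<in> T" "3 \<in> T" using e0 e1 e2 by blast+
  then have "j \<in> T" if "j < 4" for j using that unfolding less_4_iff by blast
  with T(1) show "T = {..<4}" by auto
qed

text \<open>
  An eigenvector is determined by its value at an end of the path, because each row of the
  eigenvalue equation yields the next entry.
\<close>

lemma path_eigenvalues_simple:
  assumes A: "A \<in> schroedinger_ops 4 P4"
  shows "\<exists>a b c d. a < b \<and> b < c \<and> c < d \<and> char_poly A = (\<Prod>x\<leftarrow>[a,b,c,d]. [:-x, 1:])"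
proof -
  obtain P f a b c d where P: "diagonalizes 4 P f A" and cp: "char_poly A = (\<Prod>x\<leftarrow>[a,b,c,d]. [:-x, 1:])"
    and le: "a < b" "b \<le> c" "c \<le> d"
    and count: "\<forall>x. card {i. i < 4 \<and> f i = x} = count_list [a,b,c,d] x"
    by (rule sorted_spectrum_4[OF A connected_graph_P4]) (rule that; assumption)
  have Ac: "A \<in> carrier_mat 4 4"
    and off: "\<And>i j. i < 4 \<Longrightarrow> j < 4 \<Longrightarrow> i \<noteq> j \<Longrightarrow> if {i,j} \<in> P4 then A $$ (i,j) < 0 else A $$ (i,j) = 0"
    using A by (auto simp: schroedinger_ops_def sym_mats_def)
  have simple: "count_list [a,b,c,d] x \<le> 1" for x
  proof (rule ccontr)
    assume "\<not> ?thesis"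
    then have "card {0::nat} < card {i. i < 4 \<and> f i = x}" using count by simp
    then obtain v where v: "v \<in> carrier_vec 4" "v \<noteq> 0\<^sub>v 4" "A *\<^sub>v v = x \<cdot>\<^sub>v v" and v0: "v $ 0 = 0"
      using eigenvector_vanishing_on[OF P, of "{0}" x] by auto
    have row: "A $$ (m,0) * v $ 0 + A $$ (m,1) * v $ 1 + A $$ (m,2) * v $ 2 + A $$ (m,3) * v $ 3 = x * v $ m"
      if "m < 4" for m
      using arg_cong[OF v(3), of "\<lambda>w. w $ m"] that v(1) Ac by (simp add: scalar_prod_def sum_less_4)
    have A01: "A $$ (0,1) \<noteq> 0" "A $$ (1,2) \<noteq> 0" "A $$ (2,3) \<noteq> 0"
      and A02: "A $$ (0,2) = 0" "A $$ (0,3) = 0" "A $$ (1,3) = 0"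
      using off[of 0 1] off[of 1 2] off[of 2 3] off[of 0 2] off[of 0 3] off[of 1 3]
      by (simp_all add: P4_def doubleton_eq_iff)
    have "v $ 1 = 0" using row[of 0] v0 A01 A02 by simp
    moreover from this have "v $ 2 = 0" using row[of 1] v0 A01 A02 by simp
    moreover from calculation have "v $ 3 = 0" using row[of 2] v0 A01 A02 by simp
    ultimately have "v $ i = 0" if "i < 4" for i using that v0 less_4_iff by auto
    then have "v = 0\<^sub>v 4" using v(1) by (intro eq_vecI) auto
    with v(2) show False ..
  qed
  have "b < c" "c < d" using le simple[of b] simple[of c] by (auto split: if_splits)
  with cp le show ?thesis by blast
qed

section \<open>Symmetric matrices of order four\<close>

lemma det_2:
  fixes A :: "'a :: comm_ring_1 mat"
  assumes A: "A \<in> carrier_mat 2 2"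
  shows "det A = A $$ (0,0) * A $$ (1,1) - A $$ (0,1) * A $$ (1,0)"
proof -
  have [simp]: "mat_delete A 0 j \<in> carrier_mat 1 1" for j
    using A by (auto simp: mat_delete_def)
  show ?thesis using A
    by (subst laplace_expansion_row[OF A, of 0])
      (auto simp: cofactor_def det_single mat_delete_def numeral_eq_Suc)
qed

lemma det_3:
  fixes A :: "'a :: comm_ring_1 mat"
  assumes A: "A \<in> carrier_mat 3 3"
  shows "det A = A $$ (0,0) * (A $$ (1,1) * A $$ (2,2) - A $$ (1,2) * A $$ (2,1))
    - A $$ (0,1) * (A $$ (1,0) * A $$ (2,2) - A $$ (1,2) * A $$ (2,0))
    + A $$ (0,2) * (A $$ (1,0) * A $$ (2,1) - A $$ (1,1) * A $$ (2,0))"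
proof -
  have [simp]: "mat_delete A 0 j \<in> carrier_mat 2 2" for j
    using A by (auto simp: mat_delete_def)
  show ?thesis using A
    by (subst laplace_expansion_row[OF A, of 0])
      (auto simp: cofactor_def det_2 mat_delete_def numeral_eq_Suc algebra_simps)
qed

lemma det_4:
  fixes A :: "'a :: comm_ring_1 mat"
  assumes A: "A \<in> carrier_mat 4 4"
  shows "det A =
    A $$ (0,0) * (A $$ (1,1) * (A $$ (2,2) * A $$ (3,3) - A $$ (2,3) * A $$ (3,2))
      - A $$ (1,2) * (A $$ (2,1) * A $$ (3,3) - A $$ (2,3) * A $$ (3,1))
      + A $$ (1,3) * (A $$ (2,1) * A $$ (3,2) - A $$ (2,2) * A $$ (3,1)))
    - A $$ (0,1) * (A $$ (1,0) * (A $$ (2,2) * A $$ (3,3) - A $$ (2,3) * A $$ (3,2))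
      - A $$ (1,2) * (A $$ (2,0) * A $$ (3,3) - A $$ (2,3) * A $$ (3,0))
      + A $$ (1,3) * (A $$ (2,0) * A $$ (3,2) - A $$ (2,2) * A $$ (3,0)))
    + A $$ (0,2) * (A $$ (1,0) * (A $$ (2,1) * A $$ (3,3) - A $$ (2,3) * A $$ (3,1))
      - A $$ (1,1) * (A $$ (2,0) * A $$ (3,3) - A $$ (2,3) * A $$ (3,0))
      + A $$ (1,3) * (A $$ (2,0) * A $$ (3,1) - A $$ (2,1) * A $$ (3,0)))
    - A $$ (0,3) * (A $$ (1,0) * (A $$ (2,1) * A $$ (3,2) - A $$ (2,2) * A $$ (3,1))
      - A $$ (1,1) * (A $$ (2,0) * A $$ (3,2) - A $$ (2,2) * A $$ (3,0))
      + A $$ (1,2) * (A $$ (2,0) * A $$ (3,1) - A $$ (2,1) * A $$ (3,0)))"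
proof -
  have [simp]: "mat_delete A 0 j \<in> carrier_mat 3 3" for j
    using A by (auto simp: mat_delete_def)
  have "det A = (\<Sum>j<4. A $$ (0,j) * cofactor A 0 j)"
    by (rule laplace_expansion_row[OF A]) simp
  also have "\<dots> = A $$ (0,0) * cofactor A 0 0 + A $$ (0,1) * cofactor A 0 1
      + A $$ (0,2) * cofactor A 0 2 + A $$ (0,3) * cofactor A 0 3"
    by (simp add: eval_nat_numeral)
  finally have expand: "det A = A $$ (0,0) * det (mat_delete A 0 0) - A $$ (0,1) * det (mat_delete A 0 1)
      + A $$ (0,2) * det (mat_delete A 0 2) - A $$ (0,3) * det (mat_delete A 0 3)"
    by (simp add: cofactor_def)
  have minor: "mat_delete A 0 j $$ (i,k) = A $$ (Suc i, if k < j then k else Suc k)" if "i < 3" "k < 3" for i j k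
    using that A by (simp add: mat_delete_def)
  show ?thesis unfolding expand by (simp add: det_3 minor; simp add: numeral_eq_Suc)
qed

definition sym4 :: "real \<Rightarrow> real \<Rightarrow> real \<Rightarrow> real \<Rightarrow> real \<Rightarrow> real \<Rightarrow> real \<Rightarrow> real \<Rightarrow> real \<Rightarrow> real \<Rightarrow> real mat" where
  "sym4 d0 d1 d2 d3 a01 a02 a03 a12 a13 a23 = mat 4 4 (\<lambda>(i, j).
     [[d0, a01, a02, a03], [a01, d1, a12, a13], [a02, a12, d2, a23], [a03, a13, a23, d3]] ! i ! j)"

lemma sym4_index:
  "sym4 d0 d1 d2 d3 a01 a02 a03 a12 a13 a23 \<in> carrier_mat 4 4"
  "sym4 d0 d1 d2 d3 a01 a02 a03 a12 a13 a23 $$ (0,0) = d0"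
  "sym4 d0 d1 d2 d3 a01 a02 a03 a12 a13 a23 $$ (1,1) = d1"
  "sym4 d0 d1 d2 d3 a01 a02 a03 a12 a13 a23 $$ (2,2) = d2"
  "sym4 d0 d1 d2 d3 a01 a02 a03 a12 a13 a23 $$ (3,3) = d3"
  "sym4 d0 d1 d2 d3 a01 a02 a03 a12 a13 a23 $$ (0,1) = a01"
  "sym4 d0 d1 d2 d3 a01 a02 a03 a12 a13 a23 $$ (1,0) = a01"
  "sym4 d0 d1 d2 d3 a01 a02 a03 a12 a13 a23 $$ (0,2) = a02"
  "sym4 d0 d1 d2 d3 a01 a02 a03 a12 a13 a23 $$ (2,0) = a02"
  "sym4 d0 d1 d2 d3 a01 a02 a03 a12 a13 a23 $$ (0,3) = a03"
  "sym4 d0 d1 d2 d3 a01 a02 a03 a12 a13 a23 $$ (3,0) = a03"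
  "sym4 d0 d1 d2 d3 a01 a02 a03 a12 a13 a23 $$ (1,2) = a12"
  "sym4 d0 d1 d2 d3 a01 a02 a03 a12 a13 a23 $$ (2,1) = a12"
  "sym4 d0 d1 d2 d3 a01 a02 a03 a12 a13 a23 $$ (1,3) = a13"
  "sym4 d0 d1 d2 d3 a01 a02 a03 a12 a13 a23 $$ (3,1) = a13"
  "sym4 d0 d1 d2 d3 a01 a02 a03 a12 a13 a23 $$ (2,3) = a23"
  "sym4 d0 d1 d2 d3 a01 a02 a03 a12 a13 a23 $$ (3,2) = a23"
  by (simp_all add: sym4_def)

lemma sym4_in_schroedinger_ops:
  "sym4 d0 d1 d2 d3 a01 a02 a03 a12 a13 a23 \<in> schroedinger_ops 4 E \<longleftrightarrow>
     (if {0,1} \<in> E then a01 < 0 else a01 = 0) \<and> (if {0,2} \<in> E then a02 < 0 else a02 = 0) \<and>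
     (if {0,3} \<in> E then a03 < 0 else a03 = 0) \<and> (if {1,2} \<in> E then a12 < 0 else a12 = 0) \<and>
     (if {1,3} \<in> E then a13 < 0 else a13 = 0) \<and> (if {2,3} \<in> E then a23 < 0 else a23 = 0)"
proof -
  let ?A = "sym4 d0 d1 d2 d3 a01 a02 a03 a12 a13 a23"
  have "transpose_mat ?A = ?A"
  proof (rule eq_matI)
    fix i j assume "i < dim_row ?A" "j < dim_col ?A"
    then have "i < 4" "j < 4" by (simp_all add: sym4_def)
    then show "transpose_mat ?A $$ (i,j) = ?A $$ (i,j)"
      unfolding less_4_iff by (elim disjE) (simp_all add: sym4_def)
  qed (simp_all add: sym4_def)
  then have sym: "(transpose_mat ?A = ?A) = True" by simp
  show ?thesis
  proof -
    have swap: "{1,0} = {0,1::nat}" "{2,0} = {0,2::nat}" "{3,0} = {0,3::nat}"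
      "{2,1} = {1,2::nat}" "{3,1} = {1,3::nat}" "{3,2} = {2,3::nat}" by auto
    have neq: "(0::nat) \<noteq> 1" "(0::nat) \<noteq> 2" "(0::nat) \<noteq> 3" "(1::nat) \<noteq> 2" "(1::nat) \<noteq> 3" "(2::nat) \<noteq> 3" by simp_all
    show ?thesis using sym
      unfolding schroedinger_ops_def sym_mats_def all_less_4 mem_Collect_eq
      by (simp only: sym4_index swap neq neq[symmetric] simp_thms)
        (rule iffI; elim conjE; intro conjI; assumption)
  qed
qed

text \<open>
  The characteristic polynomial of \<open>sym4\<close> at \<open>z\<close>, expanded along the first row, with
  transposed products collected.
\<close>

definition sym4_char :: "real \<Rightarrow> real \<Rightarrow> real \<Rightarrow> real \<Rightarrow> real \<Rightarrow> real \<Rightarrow> real \<Rightarrow> real \<Rightarrow> real \<Rightarrow> real \<Rightarrow> real \<Rightarrow> real" where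
  "sym4_char d0 d1 d2 d3 a01 a02 a03 a12 a13 a23 z =
     (z - d0) * ((z - d1) * ((z - d2) * (z - d3) - a23\<^sup>2) - a12\<^sup>2 * (z - d3) - a13\<^sup>2 * (z - d2) - 2 * a12 * a13 * a23)
     - a01\<^sup>2 * ((z - d2) * (z - d3) - a23\<^sup>2) - a02\<^sup>2 * ((z - d1) * (z - d3) - a13\<^sup>2) - a03\<^sup>2 * ((z - d1) * (z - d2) - a12\<^sup>2)
     - 2 * a01 * a02 * (a12 * (z - d3) + a13 * a23) - 2 * a01 * a03 * (a12 * a23 + a13 * (z - d2))
     - 2 * a02 * a03 * (a23 * (z - d1) + a12 * a13)"

lemma char_poly_sym4:
  assumes "\<And>z. sym4_char d0 d1 d2 d3 a01 a02 a03 a12 a13 a23 z = (z - a) * (z - b) * (z - c) * (z - d)"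
  shows "char_poly (sym4 d0 d1 d2 d3 a01 a02 a03 a12 a13 a23) = (\<Prod>x\<leftarrow>[a,b,c,d]. [:-x, 1:])"
proof -
  let ?A = "sym4 d0 d1 d2 d3 a01 a02 a03 a12 a13 a23"
  have A: "?A \<in> carrier_mat 4 4" by (rule sym4_index)
  have "poly (char_poly ?A) z = poly (\<Prod>x\<leftarrow>[a,b,c,d]. [:-x, 1:]) z" for z
  proof -
    let ?M = "- char_matrix ?A z"
    have M: "?M \<in> carrier_mat 4 4" using A by simp
    have idx: "?M $$ (i,j) = (if i = j then z else 0) - ?A $$ (i,j)" if "i < 4" "j < 4" for i j
      using that A by (auto simp: char_matrix_def)
    have entries: "?M $$ (0,0) = z - d0" "?M $$ (1,1) = z - d1" "?M $$ (2,2) = z - d2" "?M $$ (3,3) = z - d3"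
      "?M $$ (0,1) = - a01" "?M $$ (1,0) = - a01" "?M $$ (0,2) = - a02" "?M $$ (2,0) = - a02"
      "?M $$ (0,3) = - a03" "?M $$ (3,0) = - a03" "?M $$ (1,2) = - a12" "?M $$ (2,1) = - a12"
      "?M $$ (1,3) = - a13" "?M $$ (3,1) = - a13" "?M $$ (2,3) = - a23" "?M $$ (3,2) = - a23"
      by (simp_all add: idx sym4_index del: One_nat_def)
    have "poly (char_poly ?A) z = det ?M" by (rule char_poly_matrix[OF A])
    also have "\<dots> = (z - a) * (z - b) * (z - c) * (z - d)"
      unfolding assms[of z, symmetric] sym4_char_def det_4[OF M] entries by (simp add: algebra_simps power2_eq_square)
    finally show ?thesis by (simp add: algebra_simps)
  qed
  then show ?thesis by (subst poly_eq_poly_eq_iff[symmetric]) (rule ext)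
qed

text \<open>
  The hypotheses on \<open>x01\<close>, \<open>...\<close>, \<open>x23\<close> are the vanishing of the entrywise product and of the entries of
  \<open>A X - X A\<close> above the diagonal, for a symmetric matrix \<open>X\<close> with zero diagonal.  As
  \<open>A X - X A\<close> is antisymmetric, those entries determine it.
\<close>

lemma SSP_sym4I:
  fixes d0 d1 d2 d3 a01 a02 a03 a12 a13 a23 :: real
  defines "A \<equiv> sym4 d0 d1 d2 d3 a01 a02 a03 a12 a13 a23"
  assumes A: "A \<in> sym_mats 4"
    and zero: "\<And>x01 x02 x03 x12 x13 x23. \<lbrakk>a01 * x01 = 0; a02 * x02 = 0; a03 * x03 = 0;
      a12 * x12 = 0; a13 * x13 = 0; a23 * x23 = 0;
      d0 * x01 + a02 * x12 + a03 * x13 = x01 * d1 + x02 * a12 + x03 * a13;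
      d0 * x02 + a01 * x12 + a03 * x23 = x01 * a12 + x02 * d2 + x03 * a23;
      d0 * x03 + a01 * x13 + a02 * x23 = x01 * a13 + x02 * a23 + x03 * d3;
      a01 * x02 + d1 * x12 + a13 * x23 = x01 * a02 + x12 * d2 + x13 * a23;
      a01 * x03 + d1 * x13 + a12 * x23 = x01 * a03 + x12 * a23 + x13 * d3;
      a02 * x03 + a12 * x13 + d2 * x23 = x02 * a03 + x12 * a13 + x23 * d3\<rbrakk>
      \<Longrightarrow> x01 = 0 \<and> x02 = 0 \<and> x03 = 0 \<and> x12 = 0 \<and> x13 = 0 \<and> x23 = 0"
  shows "SSP 4 A"
  unfolding SSP_def
proof (intro conjI ballI impI A)
  fix X assume X: "X \<in> sym_mats 4"
    and "A \<circ>\<^sub>m X = 0\<^sub>m 4 4 \<and> 1\<^sub>m 4 \<circ>\<^sub>m X = 0\<^sub>m 4 4 \<and> A * X - X * A = 0\<^sub>m 4 4"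
  then have AX: "A \<circ>\<^sub>m X = 0\<^sub>m 4 4" and IX: "1\<^sub>m 4 \<circ>\<^sub>m X = 0\<^sub>m 4 4" and comm: "A * X - X * A = 0\<^sub>m 4 4"
    by auto
  have Ac: "A \<in> carrier_mat 4 4" and Xc: "X \<in> carrier_mat 4 4" and XT: "transpose_mat X = X"
    using A X by (auto simp: sym_mats_def)
  have sym: "X $$ (i,j) = X $$ (j,i)" if "i < 4" "j < 4" for i j
    using XT Xc that by (metis carrier_matD index_transpose_mat(1))
  have prod: "A $$ (i,j) * X $$ (i,j) = 0" if "i < 4" "j < 4" for i j
    using arg_cong[OF AX, of "\<lambda>M. M $$ (i,j)"] that Ac by (simp add: hadamard_prod_def)
  have diag: "X $$ (i,i) = 0" if "i < 4" for i
    using arg_cong[OF IX, of "\<lambda>M. M $$ (i,i)"] that by (simp add: hadamard_prod_def)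
  have com: "(\<Sum>k=0..<4. A $$ (i,k) * X $$ (k,j)) = (\<Sum>k=0..<4. X $$ (i,k) * A $$ (k,j))"
    if "i < 4" "j < 4" for i j
  proof -
    have "(A * X) $$ (i,j) - (X * A) $$ (i,j) = 0"
      using arg_cong[OF comm, of "\<lambda>M. M $$ (i,j)"] that Ac Xc by simp
    then show ?thesis using that Ac Xc by (simp add: scalar_prod_def)
  qed
  have swap: "X $$ (1,0) = X $$ (0,1)" "X $$ (2,0) = X $$ (0,2)" "X $$ (3,0) = X $$ (0,3)"
    "X $$ (2,1) = X $$ (1,2)" "X $$ (3,1) = X $$ (1,3)" "X $$ (3,2) = X $$ (2,3)"
    by (simp_all add: sym)
  have d: "X $$ (0,0) = 0" "X $$ (1,1) = 0" "X $$ (2,2) = 0" "X $$ (3,3) = 0"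
    by (simp_all add: diag)
  note entries = sum_less_4 swap d sym4_index[of d0 d1 d2 d3 a01 a02 a03 a12 a13 a23, folded A_def]
  have res: "X $$ (0,1) = 0 \<and> X $$ (0,2) = 0 \<and> X $$ (0,3) = 0 \<and> X $$ (1,2) = 0 \<and> X $$ (1,3) = 0 \<and> X $$ (2,3) = 0"
    using prod[of 0 1] prod[of 0 2] prod[of 0 3] prod[of 1 2] prod[of 1 3] prod[of 2 3]
      com[of 0 1] com[of 0 2] com[of 0 3] com[of 1 2] com[of 1 3] com[of 2 3]
    by (intro zero) (simp_all add: entries del: One_nat_def)
  show "X = 0\<^sub>m 4 4"
  proof (rule eq_matI)
    fix i j :: nat assume "i < dim_row (0\<^sub>m 4 4)" "j < dim_col (0\<^sub>m 4 4)"
    then have "i < 4" "j < 4" by simp_all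
    moreover from this have "X $$ (i,j) = 0"
      unfolding less_4_iff using res d swap by (elim disjE) (simp_all del: One_nat_def)
    ultimately show "X $$ (i,j) = 0\<^sub>m 4 4 $$ (i,j)" by simp
  qed (use Xc in auto)
qed

definition realizable :: "nat set set \<Rightarrow> real \<Rightarrow> real \<Rightarrow> real \<Rightarrow> real \<Rightarrow> bool" where
  "realizable E a b c d \<longleftrightarrow>
     (\<exists>A\<in>schroedinger_ops 4 E. SSP 4 A \<and> char_poly A = (\<Prod>x\<leftarrow>[a,b,c,d]. [:-x, 1:]))"

lemma realizableI:
  assumes "sym4 d0 d1 d2 d3 a01 a02 a03 a12 a13 a23 \<in> schroedinger_ops 4 E"
    and "\<And>x01 x02 x03 x12 x13 x23. \<lbrakk>a01 * x01 = 0; a02 * x02 = 0; a03 * x03 = 0;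
      a12 * x12 = 0; a13 * x13 = 0; a23 * x23 = 0;
      d0 * x01 + a02 * x12 + a03 * x13 = x01 * d1 + x02 * a12 + x03 * a13;
      d0 * x02 + a01 * x12 + a03 * x23 = x01 * a12 + x02 * d2 + x03 * a23;
      d0 * x03 + a01 * x13 + a02 * x23 = x01 * a13 + x02 * a23 + x03 * d3;
      a01 * x02 + d1 * x12 + a13 * x23 = x01 * a02 + x12 * d2 + x13 * a23;
      a01 * x03 + d1 * x13 + a12 * x23 = x01 * a03 + x12 * a23 + x13 * d3;
      a02 * x03 + a12 * x13 + d2 * x23 = x02 * a03 + x12 * a13 + x23 * d3\<rbrakk>
      \<Longrightarrow> x01 = 0 \<and> x02 = 0 \<and> x03 = 0 \<and> x12 = 0 \<and> x13 = 0 \<and> x23 = 0"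
    and "\<And>z. sym4_char d0 d1 d2 d3 a01 a02 a03 a12 a13 a23 z = (z - a) * (z - b) * (z - c) * (z - d)"
  shows "realizable E a b c d"
proof -
  have "sym4 d0 d1 d2 d3 a01 a02 a03 a12 a13 a23 \<in> sym_mats 4"
    using assms(1) by (simp add: schroedinger_ops_def)
  from SSP_sym4I[OF this assms(2)] char_poly_sym4[OF assms(3)] assms(1)
  show ?thesis unfolding realizable_def by blast
qed

section \<open>Inverse eigenvalue problems\<close>

text \<open>
  The left-hand side is the characteristic polynomial of the Jacobi matrix with diagonal
  \<open>e1\<close>, \<open>n1 + n2 + n3 - e1 - e2\<close>, \<open>e2\<close> and squared off-diagonal entries \<open>X\<close> and \<open>Y\<close>.  Evaluation at \<open>e1\<close> and
  \<open>e2\<close> determines \<open>X\<close> and \<open>Y\<close>, and interlacing makes them positive.  In the degenerate case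
  \<open>e1 = n2 = e2\<close> only the sum \<open>X + Y\<close> is determined.
\<close>

lemma Jacobi_3_with_prescribed_ends:
  fixes n1 n2 n3 e1 e2 :: real
  assumes "n1 < e1" "e2 < n3" "(e1 < n2 \<and> n2 < e2) \<or> (e1 = n2 \<and> e2 = n2)"
  obtains X Y where "X > 0" "Y > 0"
    "\<And>z. (z - e1) * (z - (n1 + n2 + n3 - e1 - e2)) * (z - e2) - X * (z - e2) - Y * (z - e1)
        = (z - n1) * (z - n2) * (z - n3)"
  using assms(3)
proof
  assume lt: "e1 < n2 \<and> n2 < e2"
  define X where "X = (e1 - n1) * (n2 - e1) * (n3 - e1) / (e2 - e1)"
  define Y where "Y = (e2 - n1) * (e2 - n2) * (n3 - e2) / (e2 - e1)"
  have ne: "e2 - e1 \<noteq> 0" using lt by auto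
  have X: "(e2 - e1) * X = (e1 - n1) * (n2 - e1) * (n3 - e1)" using ne by (simp add: X_def)
  have Y: "(e2 - e1) * Y = (e2 - n1) * (e2 - n2) * (n3 - e2)" using ne by (simp add: Y_def)
  have "X > 0" "Y > 0" unfolding X_def Y_def using assms lt
    by (auto intro!: divide_pos_pos mult_pos_pos)
  moreover have "(z - e1) * (z - (n1 + n2 + n3 - e1 - e2)) * (z - e2) - X * (z - e2) - Y * (z - e1)
        = (z - n1) * (z - n2) * (z - n3)" for z
  proof -
    have "(e2 - e1) * ((z - e1) * (z - (n1 + n2 + n3 - e1 - e2)) * (z - e2) - X * (z - e2) - Y * (z - e1))
      = (e2 - e1) * ((z - e1) * (z - (n1 + n2 + n3 - e1 - e2)) * (z - e2))
        - ((e2 - e1) * X) * (z - e2) - ((e2 - e1) * Y) * (z - e1)" by (simp add: algebra_simps)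
    also have "\<dots> = (e2 - e1) * ((z - n1) * (z - n2) * (z - n3))" unfolding X Y by (simp add: algebra_simps)
    finally show ?thesis using ne by simp
  qed
  ultimately show ?thesis by (rule that)
next
  assume eq: "e1 = n2 \<and> e2 = n2"
  let ?X = "(n2 - n1) * (n3 - n2) / 2"
  have "?X > 0" using assms eq by auto
  moreover have "(z - e1) * (z - (n1 + n2 + n3 - e1 - e2)) * (z - e2) - ?X * (z - e2) - ?X * (z - e1)
        = (z - n1) * (z - n2) * (z - n3)" for z
    using eq by (simp add: field_simps)
  ultimately show ?thesis using that[of ?X ?X] by simp
qed

text \<open>
  The other way to use the freedom in the Jacobi matrix is to prescribe its middle diagonal entry \<open>m\<close>, which
  can be any number strictly between the extreme eigenvalues: slide both ends down from
  \<open>n2\<close> and \<open>n3\<close> towards \<open>n1\<close> and \<open>n2\<close> at the same relative speed.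
\<close>

lemma interlacing_ends_with_sum:
  fixes n1 n2 n3 m :: real
  assumes n: "n1 < n2" "n2 < n3" and m: "n1 < m" "m < n3"
  obtains e1 e2 where "n1 < e1" "e1 < n2" "n2 < e2" "e2 < n3" "n1 + n2 + n3 - e1 - e2 = m"
proof -
  define t where "t = (m - n1) / (n3 - n1)"
  have t: "0 < t" "t < 1" and tm: "t * (n3 - n1) = m - n1" using n m by (simp_all add: t_def)
  have pos: "0 < t * (n2 - n1)" "0 < t * (n3 - n2)" using t n by simp_all
  have lt: "t * (n2 - n1) < n2 - n1" "t * (n3 - n2) < n3 - n2"
    using t n by simp_all
  have "t * (n2 - n1) + t * (n3 - n2) = m - n1" using tm by (simp add: algebra_simps)
  then show ?thesis
    using pos lt by (intro that[of "n2 - t * (n2 - n1)" "n3 - t * (n3 - n2)"]) linarith+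
qed

lemma neg_sqrt:
  fixes X :: real
  assumes "X > 0" obtains p where "p < 0" "p\<^sup>2 = X"
  using that[of "- sqrt X"] assms by simp

text \<open>
  A matrix that is invariant under reversal of the path splits into the blocks
  \<open>[[t, p], [p, u + k]]\<close> on symmetric and \<open>[[t, p], [p, u - k]]\<close> on antisymmetric vectors.
  The interlacing pairs \<open>{a, c}\<close> and \<open>{b, d}\<close> are assigned to them, and \<open>t\<close> is chosen such that both
  blocks lead to the same \<open>p\<^sup>2\<close>.
\<close>

lemma realizable_P4:
  assumes "a < b" "b < c" "c < d"
  shows "realizable P4 a b c d"
proof -
  define w where "w = b + d - a - c"
  define t where "t = (b * d - a * c) / w"
  have w: "w > 0" using assms by (simp add: w_def)
  have tw: "w * t = b * d - a * c" using w by (simp add: t_def)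
  have "w * (t - b) = (b - a) * (c - b)" "w * (c - t) = (d - c) * (c - b)"
    by (simp_all add: right_diff_distrib tw) (simp_all add: w_def algebra_simps)
  then have "w * (t - b) > 0" "w * (c - t) > 0" using assms by simp_all
  then have t: "b < t" "t < c" using w by (simp_all add: zero_less_mult_iff)
  obtain p where p: "p < 0" "p\<^sup>2 = (t - a) * (c - t)"
    using neg_sqrt[of "(t - a) * (c - t)"] t assms by auto
  have p': "p\<^sup>2 = (t - b) * (d - t)" 
  proof -
    have "(t - a) * (c - t) - (t - b) * (d - t) = b * d - a * c - w * t"
      by (simp add: w_def algebra_simps)
    then show ?thesis using tw p(2) by simp
  qed
  define u where "u = (a + b + c + d) / 2 - t"
  define k where "k = - w / 2"
  have k: "k < 0" using w by (simp add: k_def)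
  have uk: "u + k = a + c - t" "u - k = b + d - t" by (simp_all add: u_def k_def w_def field_simps)
  show ?thesis
  proof (rule realizableI[of t u u t p 0 0 k 0 p])
    show "sym4 t u u t p 0 0 k 0 p \<in> schroedinger_ops 4 P4"
      using p k by (simp add: sym4_in_schroedinger_ops P4_def doubleton_eq_iff)
  next
    fix z
    have "sym4_char t u u t p 0 0 k 0 p z
      = ((z - t) * (z - (u + k)) - p\<^sup>2) * ((z - t) * (z - (u - k)) - p\<^sup>2)"
      by (simp add: sym4_char_def power2_eq_square algebra_simps)
    also have "(z - t) * (z - (u + k)) - p\<^sup>2 = (z - a) * (z - c)" unfolding uk p(2) by (simp add: algebra_simps)
    also have "(z - t) * (z - (u - k)) - p\<^sup>2 = (z - b) * (z - d)" unfolding uk p' by (simp add: algebra_simps)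
    finally show "sym4_char t u u t p 0 0 k 0 p z = (z - a) * (z - b) * (z - c) * (z - d)" by (simp only: mult_ac)
  qed (use p k in auto)
qed

text \<open>
  The leaves \<open>1\<close> and \<open>2\<close> are twins with diagonal entry \<open>b\<close>, which splits off the eigenvalue \<open>b\<close>.  On vectors
  that agree at these leaves there remains a Jacobi matrix with the spectrum \<open>{a, c, d}\<close>, whose ends
  are \<open>b\<close> and the diagonal entry \<open>e\<close> of the third leaf.
\<close>

lemma realizable_K13:
  assumes "a < b" "b \<le> c" "c < d"
  shows "realizable K13 a b c d"
proof -
  define e where "e = (if b = c then c else (c + d) / 2)"
  define m where "m = a + c + d - b - e"
  have "a < b" "e < d" "b < c \<and> c < e \<or> b = c \<and> e = c" using assms by (auto simp: e_def)
  then obtain X Y where XY: "X > 0" "Y > 0" and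
    J: "\<And>z. (z - b) * (z - m) * (z - e) - X * (z - e) - Y * (z - b) = (z - a) * (z - c) * (z - d)"
    using Jacobi_3_with_prescribed_ends[of a b e d c] unfolding m_def by metis
  obtain p where p: "p < 0" "p\<^sup>2 = X / 2" using neg_sqrt[of "X / 2"] XY by auto
  obtain q where q: "q < 0" "q\<^sup>2 = Y" using neg_sqrt[of Y] XY by auto
  show ?thesis
  proof (rule realizableI[of m b b e p p q 0 0 0])
    show "sym4 m b b e p p q 0 0 0 \<in> schroedinger_ops 4 K13"
      using p q by (simp add: sym4_in_schroedinger_ops K13_def doubleton_eq_iff)
  next
    fix x01 x02 x03 x12 x13 x23
    assume "p * x01 = 0" "p * x02 = 0" "q * x03 = 0"
      and "m * x01 + p * x12 + q * x13 = x01 * b + x02 * 0 + x03 * 0"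
        "m * x02 + p * x12 + q * x23 = x01 * 0 + x02 * b + x03 * 0"
        "m * x03 + p * x13 + p * x23 = x01 * 0 + x02 * 0 + x03 * e"
    then have 0: "x01 = 0" "x02 = 0" "x03 = 0"
      and 1: "p * x12 = - (q * x13)" "p * x12 = - (q * x23)" "p * (x13 + x23) = 0"
      using p q by (auto simp: algebra_simps)
    then have "x13 = x23" "x13 + x23 = 0" using p q by auto
    then have "x13 = 0" "x23 = 0" by auto
    then show "x01 = 0 \<and> x02 = 0 \<and> x03 = 0 \<and> x12 = 0 \<and> x13 = 0 \<and> x23 = 0"
      using 0 1 p by simp
  next
    fix z
    have "sym4_char m b b e p p q 0 0 0 z
        = (z - b) * ((z - b) * (z - m) * (z - e) - (2 * p\<^sup>2) * (z - e) - q\<^sup>2 * (z - b))"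
      by (simp add: sym4_char_def power2_eq_square algebra_simps)
    also have "\<dots> = (z - b) * ((z - a) * (z - c) * (z - d))"
      unfolding J[symmetric] p(2) q(2) by simp
    finally show "sym4_char m b b e p p q 0 0 0 z = (z - a) * (z - b) * (z - c) * (z - d)"
      by (simp only: mult_ac)
  qed
qed

text \<open>
  The vertices \<open>1\<close> and \<open>2\<close> are adjacent twins.  With diagonal entry \<open>s - g\<close> and mutual entry \<open>g\<close> they
  contribute the eigenvalue \<open>s - 2 g = c\<close> on antisymmetric vectors and the diagonal entry \<open>s\<close> on
  symmetric ones.  The entry \<open>g\<close> is negative as soon as \<open>s < c\<close>, which leaves room for \<open>s\<close> as the lower end of
  a Jacobi matrix with the spectrum \<open>{a, b, d}\<close>.
\<close>

lemma realizable_Paw: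
  assumes "a < b" "b \<le> c" "c \<le> d" "b < d"
  shows "realizable Paw a b c d"
proof -
  define s where "s = (a + b) / 2"
  define e where "e = (b + d) / 2"
  define m where "m = a + b + d - s - e"
  have s: "a < s" "s < b" "b < e" "e < d" using assms by (simp_all add: s_def e_def)
  then obtain X Y where XY: "X > 0" "Y > 0" and
    J: "\<And>z. (z - s) * (z - m) * (z - e) - X * (z - e) - Y * (z - s) = (z - a) * (z - b) * (z - d)"
    using Jacobi_3_with_prescribed_ends[of a s e d b] unfolding m_def by metis
  obtain p where p: "p < 0" "p\<^sup>2 = X / 2" using neg_sqrt[of "X / 2"] XY by auto
  obtain q where q: "q < 0" "q\<^sup>2 = Y" using neg_sqrt[of Y] XY by auto
  define g where "g = (s - c) / 2"
  have g: "g < 0" "s - 2 * g = c" using s assms by (simp_all add: g_def field_simps)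
  show ?thesis
  proof (rule realizableI[of m "s - g" "s - g" e p p q g 0 0])
    show "sym4 m (s - g) (s - g) e p p q g 0 0 \<in> schroedinger_ops 4 Paw"
      using p q g by (simp add: sym4_in_schroedinger_ops Paw_def doubleton_eq_iff)
  next
    fix x01 x02 x03 x12 x13 x23
    assume "p * x01 = 0" "p * x02 = 0" "q * x03 = 0" "g * x12 = 0"
      "m * x01 + p * x12 + q * x13 = x01 * (s - g) + x02 * g + x03 * 0"
      "m * x02 + p * x12 + q * x23 = x01 * g + x02 * (s - g) + x03 * 0"
    then show "x01 = 0 \<and> x02 = 0 \<and> x03 = 0 \<and> x12 = 0 \<and> x13 = 0 \<and> x23 = 0"
      using p q g by auto
  next
    fix z
    have "sym4_char m (s - g) (s - g) e p p q g 0 0 z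
        = (z - (s - 2 * g)) * ((z - s) * (z - m) * (z - e) - (2 * p\<^sup>2) * (z - e) - q\<^sup>2 * (z - s))"
      by (simp add: sym4_char_def power2_eq_square algebra_simps)
    also have "\<dots> = (z - c) * ((z - a) * (z - b) * (z - d))"
      unfolding J[symmetric] p(2) q(2) g(2) by simp
    finally show "sym4_char m (s - g) (s - g) e p p q g 0 0 z = (z - a) * (z - b) * (z - c) * (z - d)"
      by (simp only: mult_ac)
  qed
qed

text \<open>
  The opposite vertices \<open>1\<close> and \<open>3\<close> are twins with diagonal entry \<open>b\<close>, which splits off the eigenvalue \<open>b\<close>;
  \<open>b\<close> is also the middle diagonal entry of the remaining Jacobi matrix, with the spectrum \<open>{a, c, d}\<close>.
  For the strong spectral property the diagonal entries \<open>e\<close> and \<open>f\<close> at \<open>0\<close> and \<open>2\<close> have to differ.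
\<close>

lemma realizable_C4:
  assumes "a < b" "b \<le> c" "c < d"
  shows "realizable C4 a b c d"
proof -
  obtain e f where e: "a < e" "e < c" "c < f" "f < d" and m: "a + c + d - e - f = b"
    using interlacing_ends_with_sum[of a c d b] assms by auto
  then obtain X Y where XY: "X > 0" "Y > 0" and
    J: "\<And>z. (z - e) * (z - b) * (z - f) - X * (z - f) - Y * (z - e) = (z - a) * (z - c) * (z - d)"
    using Jacobi_3_with_prescribed_ends[of a e f d c] by metis
  obtain p where p: "p < 0" "p\<^sup>2 = X / 2" using neg_sqrt[of "X / 2"] XY by auto
  obtain q where q: "q < 0" "q\<^sup>2 = Y / 2" using neg_sqrt[of "Y / 2"] XY by auto
  show ?thesis
  proof (rule realizableI[of e b f b p 0 p q 0 q])
    show "sym4 e b f b p 0 p q 0 q \<in> schroedinger_ops 4 C4"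
      using p q by (simp add: sym4_in_schroedinger_ops C4_def doubleton_eq_iff)
  next
    fix x01 x02 x03 x12 x13 x23
    assume "p * x01 = 0" "p * x03 = 0" "q * x12 = 0" "q * x23 = 0"
      "e * x01 + 0 * x12 + p * x13 = x01 * b + x02 * q + x03 * 0"
      "e * x02 + p * x12 + p * x23 = x01 * q + x02 * f + x03 * q"
    moreover from this have "x02 = 0" using p q e by auto
    ultimately show "x01 = 0 \<and> x02 = 0 \<and> x03 = 0 \<and> x12 = 0 \<and> x13 = 0 \<and> x23 = 0"
      using p q by auto
  next
    fix z
    have "sym4_char e b f b p 0 p q 0 q z
        = (z - b) * ((z - e) * (z - b) * (z - f) - (2 * p\<^sup>2) * (z - f) - (2 * q\<^sup>2) * (z - e))"
      by (simp add: sym4_char_def power2_eq_square algebra_simps)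
    also have "\<dots> = (z - b) * ((z - a) * (z - c) * (z - d))"
      unfolding J[symmetric] p(2) q(2) by simp
    finally show "sym4_char e b f b p 0 p q 0 q z = (z - a) * (z - b) * (z - c) * (z - d)"
      by (simp only: mult_ac)
  qed
qed

text \<open>
  The vertices \<open>0\<close> and \<open>1\<close> are adjacent twins, as for the paw, but now the symmetric combination is in
  the middle of the Jacobi matrix with the spectrum \<open>{a, b, d}\<close>, so that the middle diagonal entry is the one
  that has to lie below \<open>c\<close>.
\<close>

lemma realizable_Dmnd:
  assumes "a < b" "b \<le> c" "c \<le> d" "b < d"
  shows "realizable Dmnd a b c d"
proof -
  define s where "s = (a + b) / 2"
  have s: "a < s" "s < b" using assms by (simp_all add: s_def)
  obtain e f where e: "a < e" "e < b" "b < f" "f < d" and m: "a + b + d - e - f = s"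
    using interlacing_ends_with_sum[of a b d s] assms s by auto
  then obtain X Y where XY: "X > 0" "Y > 0" and
    J: "\<And>z. (z - e) * (z - s) * (z - f) - X * (z - f) - Y * (z - e) = (z - a) * (z - b) * (z - d)"
    using Jacobi_3_with_prescribed_ends[of a e f d b] by metis
  obtain p where p: "p < 0" "p\<^sup>2 = X / 2" using neg_sqrt[of "X / 2"] XY by auto
  obtain q where q: "q < 0" "q\<^sup>2 = Y / 2" using neg_sqrt[of "Y / 2"] XY by auto
  define g where "g = (s - c) / 2"
  have g: "g < 0" "s - 2 * g = c" using s assms by (simp_all add: g_def field_simps)
  show ?thesis
  proof (rule realizableI[of "s - g" "s - g" e f g p q p q 0])
    show "sym4 (s - g) (s - g) e f g p q p q 0 \<in> schroedinger_ops 4 Dmnd"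
      using p q g by (simp add: sym4_in_schroedinger_ops Dmnd_def K4_def doubleton_eq_iff)
  next
    fix x01 x02 x03 x12 x13 x23
    assume "g * x01 = 0" "p * x02 = 0" "q * x03 = 0" "p * x12 = 0" "q * x13 = 0"
      "(s - g) * x03 + g * x13 + p * x23 = x01 * q + x02 * 0 + x03 * f"
    then show "x01 = 0 \<and> x02 = 0 \<and> x03 = 0 \<and> x12 = 0 \<and> x13 = 0 \<and> x23 = 0"
      using p q g by auto
  next
    fix z
    have "sym4_char (s - g) (s - g) e f g p q p q 0 z
        = (z - (s - 2 * g)) * ((z - e) * (z - s) * (z - f) - (2 * p\<^sup>2) * (z - f) - (2 * q\<^sup>2) * (z - e))"
      by (simp add: sym4_char_def power2_eq_square algebra_simps)
    also have "\<dots> = (z - c) * ((z - a) * (z - b) * (z - d))"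
      unfolding J[symmetric] p(2) q(2) g(2) by simp
    finally show "sym4_char (s - g) (s - g) e f g p q p q 0 z = (z - a) * (z - b) * (z - c) * (z - d)"
      by (simp only: mult_ac)
  qed
qed

text \<open>
  Two pairs of adjacent twins, \<open>{0, 1}\<close> and \<open>{2, 3}\<close>, contribute \<open>c\<close> and \<open>d\<close> on antisymmetric vectors.
  On the remaining plane the matrix is \<open>[[s, 2 k], [2 k, s]]\<close>, with the eigenvalues \<open>a\<close> and \<open>b\<close>.
  The entries inside the pairs are negative because the mean \<open>s\<close> of \<open>a\<close> and \<open>b\<close> lies below \<open>c\<close> and \<open>d\<close>.
\<close>

lemma realizable_K4:
  assumes "a < b" "b \<le> c" "c \<le> d"
  shows "realizable K4 a b c d"
proof -
  define s where "s = (a + b) / 2"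
  define k where "k = (a - b) / 4"
  have k: "k < 0" and s: "s < c" "s < d" using assms by (simp_all add: k_def s_def)
  have s2k: "s + 2 * k = a" "s - 2 * k = b" by (simp_all add: s_def k_def field_simps)
  define g where "g = (s - c) / 2"
  define h where "h = (s - d) / 2"
  have gh: "g < 0" "h < 0" using s by (simp_all add: g_def h_def)
  have c: "c = s - 2 * g" and d: "d = s - 2 * h" by (simp_all add: g_def h_def field_simps)
  show ?thesis
  proof (rule realizableI[of "s - g" "s - g" "s - h" "s - h" g k k k k h])
    show "sym4 (s - g) (s - g) (s - h) (s - h) g k k k k h \<in> schroedinger_ops 4 K4"
      using gh k by (simp add: sym4_in_schroedinger_ops K4_def doubleton_eq_iff)
  next
    fix x01 x02 x03 x12 x13 x23
    assume "g * x01 = 0" "k * x02 = 0" "k * x03 = 0" "k * x12 = 0" "k * x13 = 0" "h * x23 = 0"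
    then show "x01 = 0 \<and> x02 = 0 \<and> x03 = 0 \<and> x12 = 0 \<and> x13 = 0 \<and> x23 = 0"
      using gh k by simp
  next
    fix z
    show "sym4_char (s - g) (s - g) (s - h) (s - h) g k k k k h z = (z - a) * (z - b) * (z - c) * (z - d)"
      unfolding c d s2k[symmetric] by (simp add: sym4_char_def power2_eq_square algebra_simps)
  qed
qed

section \<open>The ordered multiplicity lists of graphs on four vertices\<close>

text \<open>
  Distinct eigenvalues together with a list of \<open>L\<close> amount to a spectrum \<open>a < b \<le> c \<le> d\<close> with repetitions, so
  \<open>suf\<close> makes every list of \<open>L\<close> spectrally arbitrary.  Such a list is in particular allowed, as one sees
  from any choice of eigenvalues, for instance \<open>0, 1, 2, ...\<close>.
\<close>

lemma multiplicity_lists_from_spectra: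
  assumes L: "L \<subseteq> {[1,1,1,1], [1,2,1], [1,1,2], [1,3]}"
    and nec: "\<And>A. A \<in> schroedinger_ops 4 E \<Longrightarrow> \<exists>a b c d. a < b \<and> b \<le> c \<and> c \<le> d \<and>
        mult_pattern a b c d \<in> L \<and> char_poly A = (\<Prod>x\<leftarrow>[a,b,c,d]. [:-x, 1:])"
    and suf: "\<And>a b c d. \<lbrakk>a < b; b \<le> c; c \<le> d; mult_pattern a b c d \<in> L\<rbrakk> \<Longrightarrow> realizable E a b c d"
  shows "{ms. allowed 4 E ms} = L \<and> (\<forall>ms\<in>L. spectrally_arbitrary_SSP 4 E ms)"
proof -
  have SA: "spectrally_arbitrary_SSP 4 E ms" if ms: "ms \<in> L" for ms
    unfolding spectrally_arbitrary_SSP_def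
  proof (intro allI impI)
    fix ls :: "real list"
    assume ls: "length ls = length ms \<and> sorted_wrt (<) ls"
    have "\<exists>a b c d. a < b \<and> b \<le> c \<and> c \<le> d \<and> mult_pattern a b c d = ms \<and> remdups [a,b,c,d] = ls"
    proof -
      consider "ms = [1,1,1,1]" | "ms = [1,2,1]" | "ms = [1,1,2]" | "ms = [1,3]" using L ms by blast
      then show ?thesis
      proof cases
        case 1
        then obtain a b c d where "ls = [a,b,c,d]" using ls by (auto simp: length_Suc_conv)
        then show ?thesis using ls 1
          by (intro exI[of _ a] exI[of _ b] exI[of _ c] exI[of _ d]) (auto simp: mult_pattern_def)
      next
        case 2
        then obtain a b d where "ls = [a,b,d]" using ls by (auto simp: length_Suc_conv)
        then show ?thesis using ls 2
          by (intro exI[of _ a] exI[of _ b] exI[of _ b] exI[of _ d]) (auto simp: mult_pattern_def)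
      next
        case 3
        then obtain a b d where "ls = [a,b,d]" using ls by (auto simp: length_Suc_conv)
        then show ?thesis using ls 3
          by (intro exI[of _ a] exI[of _ b] exI[of _ d] exI[of _ d]) (auto simp: mult_pattern_def)
      next
        case 4
        then obtain a d where "ls = [a,d]" using ls by (auto simp: length_Suc_conv)
        then show ?thesis using ls 4
          by (intro exI[of _ a] exI[of _ d] exI[of _ d] exI[of _ d]) (auto simp: mult_pattern_def)
      qed
    qed
    then obtain a b c d where le: "a < b" "b \<le> c" "c \<le> d"
      and pat: "mult_pattern a b c d = ms" "remdups [a,b,c,d] = ls" by blast
    obtain A where A: "A \<in> schroedinger_ops 4 E" "SSP 4 A" "char_poly A = (\<Prod>x\<leftarrow>[a,b,c,d]. [:-x, 1:])"
      using suf[OF le] pat ms by (auto simp: realizable_def)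
    have "A \<in> carrier_mat 4 4" using A(1) by (simp add: schroedinger_ops_def sym_mats_def)
    from ordered_mult_list_4[OF this A(3) le] A pat
    show "\<exists>A\<in>schroedinger_ops 4 E. SSP 4 A \<and> distinct_eigenvalues A = ls \<and> ordered_mult_list A = ms"
      by blast
  qed
  have "allowed 4 E ms" if "ms \<in> L" for ms
  proof -
    have "sorted_wrt (<) (map real [0..<length ms])" by (simp add: sorted_wrt_map)
    then show ?thesis
      using SA[OF that] unfolding spectrally_arbitrary_SSP_def allowed_def
      by (metis length_map length_upt diff_zero)
  qed
  moreover have "ms \<in> L" if "allowed 4 E ms" for ms
  proof -
    from that obtain A where A: "A \<in> schroedinger_ops 4 E" and ms: "ordered_mult_list A = ms"
      by (auto simp: allowed_def)
    obtain a b c d where "a < b" "b \<le> c" "c \<le> d" "mult_pattern a b c d \<in> L"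
      "char_poly A = (\<Prod>x\<leftarrow>[a,b,c,d]. [:-x, 1:])"
      using nec[OF A] by blast
    moreover have "A \<in> carrier_mat 4 4" using A by (simp add: schroedinger_ops_def sym_mats_def)
    ultimately show ?thesis using ordered_mult_list_4 ms by metis
  qed
  ultimately show ?thesis using SA by blast
qed

lemma P4_lists:
  "{ms. allowed 4 P4 ms} = {[1,1,1,1]} \<and> (\<forall>ms\<in>{[1,1,1,1]}. spectrally_arbitrary_SSP 4 P4 ms)"
proof (rule multiplicity_lists_from_spectra)
  fix A assume "A \<in> schroedinger_ops 4 P4"
  then obtain a b c d where "a < b" "b < c" "c < d" "char_poly A = (\<Prod>x\<leftarrow>[a,b,c,d]. [:-x, 1:])"
    using path_eigenvalues_simple by blast
  then show "\<exists>a b c d. a < b \<and> b \<le> c \<and> c \<le> d \<and> mult_pattern a b c d \<in> {[1,1,1,1]} \<and>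
      char_poly A = (\<Prod>x\<leftarrow>[a,b,c,d]. [:-x, 1:])"
    by (intro exI[of _ a] exI[of _ b] exI[of _ c] exI[of _ d]) (simp add: mult_pattern_def)
qed (auto simp: mult_pattern_def split: if_splits intro: realizable_P4)

lemma bipartite_lists:
  assumes conn: "connected_graph 4 E" and bip: "\<And>i j. {i,j} \<in> E \<Longrightarrow> i \<in> V \<longleftrightarrow> j \<notin> V"
    and real: "\<And>a b c d. \<lbrakk>a < b; b \<le> c; c < d\<rbrakk> \<Longrightarrow> realizable E a b c d"
  shows "{ms. allowed 4 E ms} = {[1,1,1,1], [1,2,1]} \<and>
    (\<forall>ms\<in>{[1,1,1,1], [1,2,1]}. spectrally_arbitrary_SSP 4 E ms)"
proof (rule multiplicity_lists_from_spectra)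
  fix A assume "A \<in> schroedinger_ops 4 E"
  then obtain a b c d where "a < b" "b \<le> c" "c < d" "char_poly A = (\<Prod>x\<leftarrow>[a,b,c,d]. [:-x, 1:])"
    using largest_eigenvalue_simple_bipartite[OF _ conn bip] by blast
  then show "\<exists>a b c d. a < b \<and> b \<le> c \<and> c \<le> d \<and> mult_pattern a b c d \<in> {[1,1,1,1], [1,2,1]} \<and>
      char_poly A = (\<Prod>x\<leftarrow>[a,b,c,d]. [:-x, 1:])"
    by (intro exI[of _ a] exI[of _ b] exI[of _ c] exI[of _ d]) (simp add: mult_pattern_def)
qed (auto simp: mult_pattern_def split: if_splits intro: real)

lemma noncomplete_lists:
  assumes conn: "connected_graph 4 E"
    and ijk: "i < 4" "j < 4" "k < 4" "i \<noteq> j" "{i,k} \<in> E" "{k,j} \<in> E" "{i,j} \<notin> E" "i \<noteq> k" "j \<noteq> k"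
    and real: "\<And>a b c d. \<lbrakk>a < b; b \<le> c; c \<le> d; b < d\<rbrakk> \<Longrightarrow> realizable E a b c d"
  shows "{ms. allowed 4 E ms} = {[1,1,1,1], [1,2,1], [1,1,2]} \<and>
    (\<forall>ms\<in>{[1,1,1,1], [1,2,1], [1,1,2]}. spectrally_arbitrary_SSP 4 E ms)"
proof (rule multiplicity_lists_from_spectra)
  fix A assume "A \<in> schroedinger_ops 4 E"
  then obtain a b c d where "a < b" "b \<le> c" "c \<le> d" "b < d" "char_poly A = (\<Prod>x\<leftarrow>[a,b,c,d]. [:-x, 1:])"
    using no_triple_eigenvalue_induced_path[OF _ conn ijk] by blast
  then show "\<exists>a b c d. a < b \<and> b \<le> c \<and> c \<le> d \<and> mult_pattern a b c d \<in> {[1,1,1,1], [1,2,1], [1,1,2]} \<and>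
      char_poly A = (\<Prod>x\<leftarrow>[a,b,c,d]. [:-x, 1:])"
    by (intro exI[of _ a] exI[of _ b] exI[of _ c] exI[of _ d]) (auto simp: mult_pattern_def)
qed (auto simp: mult_pattern_def split: if_splits intro: real)

lemma K4_lists:
  "{ms. allowed 4 K4 ms} = {[1,1,1,1], [1,2,1], [1,1,2], [1,3]} \<and>
    (\<forall>ms\<in>{[1,1,1,1], [1,2,1], [1,1,2], [1,3]}. spectrally_arbitrary_SSP 4 K4 ms)"
proof (rule multiplicity_lists_from_spectra)
  fix A assume A: "A \<in> schroedinger_ops 4 K4"
  have "connected_graph 4 K4"
    by (rule connected_graph_mono[OF connected_graph_K13]) (auto simp: K13_def K4_def)
  from sorted_spectrum_4[OF A this] obtain a b c d
    where "a < b" "b \<le> c" "c \<le> d" "char_poly A = (\<Prod>x\<leftarrow>[a,b,c,d]. [:-x, 1:])"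
    by metis
  then show "\<exists>a b c d. a < b \<and> b \<le> c \<and> c \<le> d \<and>
      mult_pattern a b c d \<in> {[1,1,1,1], [1,2,1], [1,1,2], [1,3]} \<and>
      char_poly A = (\<Prod>x\<leftarrow>[a,b,c,d]. [:-x, 1:])"
    by (intro exI[of _ a] exI[of _ b] exI[of _ c] exI[of _ d]) (simp add: mult_pattern_def)
qed (auto intro: realizable_K4)

lemma K13_lists:
  "{ms. allowed 4 K13 ms} = {[1,1,1,1], [1,2,1]} \<and>
    (\<forall>ms\<in>{[1,1,1,1], [1,2,1]}. spectrally_arbitrary_SSP 4 K13 ms)"
  by (rule bipartite_lists[where V = "{0}", OF connected_graph_K13 _ realizable_K13])
    (auto simp: K13_def doubleton_eq_iff)

lemma C4_lists:
  "{ms. allowed 4 C4 ms} = {[1,1,1,1], [1,2,1]} \<and>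
    (\<forall>ms\<in>{[1,1,1,1], [1,2,1]}. spectrally_arbitrary_SSP 4 C4 ms)"
proof (rule bipartite_lists[where V = "{0, 2}", OF _ _ realizable_C4])
  show "connected_graph 4 C4"
    by (rule connected_graph_mono[OF connected_graph_P4]) (auto simp: P4_def C4_def)
qed (auto simp: C4_def doubleton_eq_iff)

lemma Paw_lists:
  "{ms. allowed 4 Paw ms} = {[1,1,1,1], [1,2,1], [1,1,2]} \<and>
    (\<forall>ms\<in>{[1,1,1,1], [1,2,1], [1,1,2]}. spectrally_arbitrary_SSP 4 Paw ms)"
proof (rule noncomplete_lists[of Paw 1 3 0, OF _ _ _ _ _ _ _ _ _ _ realizable_Paw])
  show "connected_graph 4 Paw"
    by (rule connected_graph_mono[OF connected_graph_K13]) (auto simp: K13_def Paw_def)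
qed (auto simp: Paw_def doubleton_eq_iff)

lemma Dmnd_lists:
  "{ms. allowed 4 Dmnd ms} = {[1,1,1,1], [1,2,1], [1,1,2]} \<and>
    (\<forall>ms\<in>{[1,1,1,1], [1,2,1], [1,1,2]}. spectrally_arbitrary_SSP 4 Dmnd ms)"
proof (rule noncomplete_lists[of Dmnd 2 3 0, OF _ _ _ _ _ _ _ _ _ _ realizable_Dmnd])
  show "connected_graph 4 Dmnd"
    by (rule connected_graph_mono[OF connected_graph_K13])
      (auto simp: K13_def Dmnd_def K4_def doubleton_eq_iff)
qed (auto simp: Dmnd_def K4_def doubleton_eq_iff)

theorem theorem4p1:
  shows "\<forall>(G, L) \<in>
      {(P4,   {[1,1,1,1]}),
       (K13,  {[1,1,1,1], [1,2,1]}),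
       (Paw,  {[1,1,1,1], [1,2,1], [1,1,2]}),
       (C4,   {[1,1,1,1], [1,2,1]}),
       (Dmnd, {[1,1,1,1], [1,2,1], [1,1,2]}),
       (K4,   {[1,1,1,1], [1,2,1], [1,1,2], [1,3]})}.
    {ms. allowed 4 G ms} = L \<and> (\<forall>ms \<in> L. spectrally_arbitrary_SSP 4 G ms)"
  by (intro ballI; elim insertE emptyE; hypsubst; unfold prod.case;
      rule P4_lists K13_lists Paw_lists C4_lists Dmnd_lists K4_lists)

end
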